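(* Let $\mathcal{C}$ be a group-like monoidal groupoid with invariants the abelian groups $\pi_0(\mathcal{C})=B$ and $\pi_1(\mathcal{C},I)=\mathrm{Aut}_{\mathcal{C}}(I)=A$, such that the $B$-module structure on $A$ is trivial, and whose associated trilinear map $$\varphi_{\mathcal{C}}(x,y,z)=\frac{f(x,y,z)\,f(z,x,y)\,f(y,z,x)}{f(x,z,y)\,f(z,y,x)\,f(y,x,z)}$$ (where $f$ is a 3-cocycle describing $\mathcal{C}$) is trivial. Then the associated commutator biextension $E$ of $B\times B$ by $A$ is alternating.
   Context: $A$ is written multiplicatively, $B$ additively. A group-like monoidal groupoid is a monoidal category $\mathcal{C}$ (tensor product written $XY$, unit $I$, associativity isomorphisms $a_{X,Y,Z}:X(YZ)\to(XY)Z$) in which all arrows are invertible and each object is invertible up to isomorphism. $\pi_0(\mathcal{C})$ is the group of isomorphism classes of objects. Each $\mathrm{Aut}(X)$ is identified with $A$ by $a\mapsto a\otimes X$; then $a\mapsto X\otimes a$ defines the action on $A$ of the class of $X$ in $B$. Cocycle: choose objects $X_x$ of class $x$ and arrows $c_{x,y}:X_xX_y\to X_{x+y}$; $f(x,y,z)\in\mathrm{Aut}(X_{x+y+z})=A$ is defined by $c_{x+y,z}\circ(c_{x,y}X_z)\circ a_{x,y,z}=f(x,y,z)\circ c_{x,y+z}\circ(X_xc_{y,z})$. Commutator: the $A$-torsor $E$ on $B\times B$ with fibres $E_{x,y}=\mathrm{Isom}_{\mathcal{C}}(X_yX_x,X_xX_y)$, with partial laws: for $u\in E_{x,y}$, $v\in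 E_{x',y}$, $u\stackrel{1}{+}v\in E_{x+x',y}$ is $$X_yX_{x+x'}\to X_y(X_xX_{x'})\to(X_yX_x)X_{x'}\xrightarrow{u}(X_xX_y)X_{x'}\to X_x(X_yX_{x'})\xrightarrow{v}X_x(X_{x'}X_y)\to(X_xX_{x'})X_y\to X_{x+x'}X_y;$$ for $u\in E_{x,y}$, $w\in E_{x,y'}$, $u\stackrel{2}{+}w\in E_{x,y+y'}$ is $$X_{y+y'}X_x\to(X_yX_{y'})X_x\to X_y(X_{y'}X_x)\xrightarrow{w}X_y(X_xX_{y'})\to(X_yX_x)X_{y'}\xrightarrow{u}(X_xX_y)X_{y'}\to X_x(X_yX_{y'})\to X_xX_{y+y'}$$ (unlabelled arrows: associativity isomorphisms, and arrows induced by $c^{\pm1}$ at the ends). When $\varphi_{\mathcal{C}}$ is trivial this is a biextension: the two laws are morphisms of $A$-torsors, associative, commutative, and $(a\stackrel{1}{+}b)\stackrel{2}{+}(c\stackrel{1}{+}d)=(a\stackrel{2}{+}c)\stackrel{1}{+}(b\stackrel{2}{+}d)$ whenever both sides make sense. Alternating: a biextension gives canonical isomorphisms $E_{x+y,x+y}\simeq E_{x,x}\wedge E_{x,y}\wedge E_{y,x}\wedge E_{y,y}$ ($\wedge$ the contracted product of $A$-torsors), whence on the diagonal restriction $\Delta E$ (with $\Delta E_x=E_{x,x}$) canonical isomorphisms $\sigma_x:\Delta E_{-x}\to\Delta E_x$ (symmetry) and $\Delta E_{x+y+z}\wedge\Delta E_x\wedge\Delta E_y\wedge\Delta E_z\simeq\Delta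 E_{x+y}\wedge\Delta E_{x+z}\wedge\Delta E_{y+z}$ (cube structure), together called the $\Sigma$-structure. A biextension is alternating when it is endowed with a section $t$ of $\Delta E$ compatible with the $\Sigma$-structure: $\sigma_x(t(-x))=t(x)$, and $t(x+y+z)\wedge t(x)\wedge t(y)\wedge t(z)$ corresponds to $t(x+y)\wedge t(x+z)\wedge t(y+z)$. *)

theory Defs
  imports "HOL-Algebra.Group"
begin

section \<open>Monoidal categories\<close>

record ('o, 'm) monoidal_data =
  Ob :: "'o set"
  Arr :: "'m set"
  Dom :: "'m \<Rightarrow> 'o"
  Cod :: "'m \<Rightarrow> 'o"
  Id :: "'o \<Rightarrow> 'm"
  Comp :: "'m \<Rightarrow> 'm \<Rightarrow> 'm"  (infixr \<open>\<cdot>\<index>\<close> 65)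
  TenO :: "'o \<Rightarrow> 'o \<Rightarrow> 'o"  (infixl \<open>\<odot>\<index>\<close> 75)
  TenA :: "'m \<Rightarrow> 'm \<Rightarrow> 'm"  (infixl \<open>\<boxtimes>\<index>\<close> 75)
  Unit :: 'o
  Assoc :: "'o \<Rightarrow> 'o \<Rightarrow> 'o \<Rightarrow> 'm"
  LUnit :: "'o \<Rightarrow> 'm"
  RUnit :: "'o \<Rightarrow> 'm"

definition Hom :: "('o, 'm, 'z) monoidal_data_scheme \<Rightarrow> 'o \<Rightarrow> 'o \<Rightarrow> 'm set" where
  "Hom C X Y = {f \<in> Arr C. Dom C f = X \<and> Cod C f = Y}"

definition inverse_arrows :: "('o, 'm, 'z) monoidal_data_scheme \<Rightarrow> 'm \<Rightarrow> 'm \<Rightarrow> bool" where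
  "inverse_arrows C f g \<longleftrightarrow>
     g \<in> Hom C (Cod C f) (Dom C f) \<and>
     g \<cdot>\<^bsub>C\<^esub> f = Id C (Dom C f) \<and> f \<cdot>\<^bsub>C\<^esub> g = Id C (Cod C f)"

definition Isom :: "('o, 'm, 'z) monoidal_data_scheme \<Rightarrow> 'o \<Rightarrow> 'o \<Rightarrow> 'm set" where
  "Isom C X Y = {f \<in> Hom C X Y. \<exists>g. inverse_arrows C f g}"

definition Inv :: "('o, 'm, 'z) monoidal_data_scheme \<Rightarrow> 'm \<Rightarrow> 'm" where
  "Inv C f = (THE g. inverse_arrows C f g)"

definition isomorphic :: "('o, 'm, 'z) monoidal_data_scheme \<Rightarrow> 'o \<Rightarrow> 'o \<Rightarrow> bool" where
  "isomorphic C X Y \<longleftrightarrow> Isom C X Y \<noteq> {}"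

locale category =
  fixes C :: "('o, 'm, 'z) monoidal_data_scheme" (structure)
  assumes Dom_closed: "f \<in> Arr C \<Longrightarrow> Dom C f \<in> Ob C"
    and Cod_closed: "f \<in> Arr C \<Longrightarrow> Cod C f \<in> Ob C"
    and Id_closed: "X \<in> Ob C \<Longrightarrow> Id C X \<in> Hom C X X"
    and Comp_closed: "\<lbrakk>f \<in> Hom C X Y; g \<in> Hom C Y Z\<rbrakk> \<Longrightarrow> g \<cdot> f \<in> Hom C X Z"
    and Comp_Id: "f \<in> Hom C X Y \<Longrightarrow> f \<cdot> Id C X = f"
    and Id_Comp: "f \<in> Hom C X Y \<Longrightarrow> Id C Y \<cdot> f = f"
    and Comp_assoc: "\<lbrakk>f \<in> Hom C X Y; g \<in> Hom C Y Z; h \<in> Hom C Z W\<rbrakk>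
          \<Longrightarrow> (h \<cdot> g) \<cdot> f = h \<cdot> (g \<cdot> f)"

text \<open>The associativity isomorphisms go from \<open>X \<odot> (Y \<odot> Z)\<close> to \<open>(X \<odot> Y) \<odot> Z\<close>, which
  determines the direction in which the pentagon and the triangle are written.\<close>

locale monoidal_category = category +
  assumes Unit_closed: "Unit C \<in> Ob C"
    and TenO_closed: "\<lbrakk>X \<in> Ob C; Y \<in> Ob C\<rbrakk> \<Longrightarrow> X \<odot> Y \<in> Ob C"
    and TenA_closed: "\<lbrakk>f \<in> Hom C X X'; g \<in> Hom C Y Y'\<rbrakk>
          \<Longrightarrow> f \<boxtimes> g \<in> Hom C (X \<odot> Y) (X' \<odot> Y')"
    and TenA_Id: "\<lbrakk>X \<in> Ob C; Y \<in> Ob C\<rbrakk> \<Longrightarrow> Id C X \<boxtimes> Id C Y = Id C (X \<odot> Y)"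
    and TenA_Comp: "\<lbrakk>f \<in> Hom C X X'; f' \<in> Hom C X' X''; g \<in> Hom C Y Y'; g' \<in> Hom C Y' Y''\<rbrakk>
          \<Longrightarrow> (f' \<cdot> f) \<boxtimes> (g' \<cdot> g) = (f' \<boxtimes> g') \<cdot> (f \<boxtimes> g)"
    and Assoc_Isom: "\<lbrakk>X \<in> Ob C; Y \<in> Ob C; Z \<in> Ob C\<rbrakk>
          \<Longrightarrow> Assoc C X Y Z \<in> Isom C (X \<odot> (Y \<odot> Z)) ((X \<odot> Y) \<odot> Z)"
    and Assoc_natural: "\<lbrakk>f \<in> Hom C X X'; g \<in> Hom C Y Y'; h \<in> Hom C Z Z'\<rbrakk>
          \<Longrightarrow> Assoc C X' Y' Z' \<cdot> (f \<boxtimes> (g \<boxtimes> h)) = ((f \<boxtimes> g) \<boxtimes> h) \<cdot> Assoc C X Y Z"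
    and LUnit_Isom: "X \<in> Ob C \<Longrightarrow> LUnit C X \<in> Isom C (Unit C \<odot> X) X"
    and LUnit_natural: "f \<in> Hom C X Y \<Longrightarrow> LUnit C Y \<cdot> (Id C (Unit C) \<boxtimes> f) = f \<cdot> LUnit C X"
    and RUnit_Isom: "X \<in> Ob C \<Longrightarrow> RUnit C X \<in> Isom C (X \<odot> Unit C) X"
    and RUnit_natural: "f \<in> Hom C X Y \<Longrightarrow> RUnit C Y \<cdot> (f \<boxtimes> Id C (Unit C)) = f \<cdot> RUnit C X"
    and pentagon: "\<lbrakk>X \<in> Ob C; Y \<in> Ob C; Z \<in> Ob C; W \<in> Ob C\<rbrakk>
          \<Longrightarrow> (Assoc C X Y Z \<boxtimes> Id C W) \<cdot> Assoc C X (Y \<odot> Z) W \<cdot> (Id C X \<boxtimes> Assoc C Y Z W)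
            = Assoc C (X \<odot> Y) Z W \<cdot> Assoc C X Y (Z \<odot> W)"
    and triangle: "\<lbrakk>X \<in> Ob C; Y \<in> Ob C\<rbrakk>
          \<Longrightarrow> (RUnit C X \<boxtimes> Id C Y) \<cdot> Assoc C X (Unit C) Y = Id C X \<boxtimes> LUnit C Y"

locale group_like_monoidal_groupoid = monoidal_category +
  assumes arrows_invertible: "f \<in> Hom C X Y \<Longrightarrow> f \<in> Isom C X Y"
    and objects_invertible: "X \<in> Ob C
          \<Longrightarrow> \<exists>Y \<in> Ob C. isomorphic C (X \<odot> Y) (Unit C) \<and> isomorphic C (Y \<odot> X) (Unit C)"


section \<open>Invariants of a group-like monoidal groupoid\<close>

definition iso_classes :: "('o, 'm, 'z) monoidal_data_scheme \<Rightarrow> 'o set set" where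
  "iso_classes C = Ob C // {(X, Y). X \<in> Ob C \<and> Y \<in> Ob C \<and> isomorphic C X Y}"

text \<open>Both groups are written multiplicatively, as in \<^theory>\<open>HOL-Algebra.Group\<close>: the sum of
  \<open>x\<close> and \<open>y\<close> in \<open>B\<close> is \<open>x \<otimes> y\<close>, and the opposite of \<open>x\<close> is \<open>inv x\<close>.\<close>

definition pi0 :: "('o, 'm, 'z) monoidal_data_scheme \<Rightarrow> 'o set monoid" where
  "pi0 C =
     \<lparr>carrier = iso_classes C,
      mult = (\<lambda>x y. {Z \<in> Ob C. \<exists>X \<in> x. \<exists>Y \<in> y. isomorphic C (X \<odot>\<^bsub>C\<^esub> Y) Z}),
      one = {Z \<in> Ob C. isomorphic C (Unit C) Z}\<rparr>"

definition pi1 :: "('o, 'm, 'z) monoidal_data_scheme \<Rightarrow> 'm monoid" where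
  "pi1 C = \<lparr>carrier = Isom C (Unit C) (Unit C), mult = Comp C, one = Id C (Unit C)\<rparr>"

text \<open>The automorphisms \<open>a \<otimes> X\<close> and \<open>X \<otimes> a\<close> of \<open>X\<close>, for an automorphism \<open>a\<close> of the unit
  object, are transported to \<open>X\<close> by the unit constraints.\<close>

definition left_aut :: "('o, 'm, 'z) monoidal_data_scheme \<Rightarrow> 'm \<Rightarrow> 'o \<Rightarrow> 'm" where
  "left_aut C a X = LUnit C X \<cdot>\<^bsub>C\<^esub> (a \<boxtimes>\<^bsub>C\<^esub> Id C X) \<cdot>\<^bsub>C\<^esub> Inv C (LUnit C X)"

definition right_aut :: "('o, 'm, 'z) monoidal_data_scheme \<Rightarrow> 'o \<Rightarrow> 'm \<Rightarrow> 'm" where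
  "right_aut C X a = RUnit C X \<cdot>\<^bsub>C\<^esub> (Id C X \<boxtimes>\<^bsub>C\<^esub> a) \<cdot>\<^bsub>C\<^esub> Inv C (RUnit C X)"

definition pi1_action :: "('o, 'm, 'z) monoidal_data_scheme \<Rightarrow> 'o \<Rightarrow> 'm \<Rightarrow> 'm" where
  "pi1_action C X a = (THE a'. a' \<in> carrier (pi1 C) \<and> left_aut C a' X = right_aut C X a)"

definition trivial_action :: "('o, 'm, 'z) monoidal_data_scheme \<Rightarrow> bool" where
  "trivial_action C \<longleftrightarrow> (\<forall>X \<in> Ob C. \<forall>a \<in> carrier (pi1 C). pi1_action C X a = a)"

text \<open>\<open>R x\<close> is an object of class \<open>x\<close>, and \<open>c x y\<close> an arrow from \<open>R x \<odot> R y\<close> to the object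
  chosen in the class \<open>x + y\<close>.  No normalization at the zero class is required.\<close>

definition is_choice ::
  "('o, 'm, 'z) monoidal_data_scheme \<Rightarrow> ('o set \<Rightarrow> 'o) \<Rightarrow> ('o set \<Rightarrow> 'o set \<Rightarrow> 'm) \<Rightarrow> bool" where
  "is_choice C R c \<longleftrightarrow>
     (\<forall>x \<in> carrier (pi0 C). R x \<in> x) \<and>
     (\<forall>x \<in> carrier (pi0 C). \<forall>y \<in> carrier (pi0 C).
        c x y \<in> Hom C (R x \<odot>\<^bsub>C\<^esub> R y) (R (x \<otimes>\<^bsub>pi0 C\<^esub> y)))"

definition cocycle ::
  "('o, 'm, 'z) monoidal_data_scheme \<Rightarrow> ('o set \<Rightarrow> 'o) \<Rightarrow> ('o set \<Rightarrow> 'o set \<Rightarrow> 'm)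
    \<Rightarrow> 'o set \<Rightarrow> 'o set \<Rightarrow> 'o set \<Rightarrow> 'm" where
  "cocycle C R c x y z =
     (THE a. a \<in> carrier (pi1 C) \<and>
        c (x \<otimes>\<^bsub>pi0 C\<^esub> y) z \<cdot>\<^bsub>C\<^esub> (c x y \<boxtimes>\<^bsub>C\<^esub> Id C (R z)) \<cdot>\<^bsub>C\<^esub> Assoc C (R x) (R y) (R z)
        = left_aut C a (R (x \<otimes>\<^bsub>pi0 C\<^esub> y \<otimes>\<^bsub>pi0 C\<^esub> z))
            \<cdot>\<^bsub>C\<^esub> c x (y \<otimes>\<^bsub>pi0 C\<^esub> z) \<cdot>\<^bsub>C\<^esub> (Id C (R x) \<boxtimes>\<^bsub>C\<^esub> c y z))"

definition trilinear_map ::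
  "('o, 'm, 'z) monoidal_data_scheme \<Rightarrow> ('o set \<Rightarrow> 'o) \<Rightarrow> ('o set \<Rightarrow> 'o set \<Rightarrow> 'm)
    \<Rightarrow> 'o set \<Rightarrow> 'o set \<Rightarrow> 'o set \<Rightarrow> 'm" where
  "trilinear_map C R c x y z =
     (let f = cocycle C R c in
        (f x y z \<otimes>\<^bsub>pi1 C\<^esub> f z x y \<otimes>\<^bsub>pi1 C\<^esub> f y z x)
        \<otimes>\<^bsub>pi1 C\<^esub> inv\<^bsub>pi1 C\<^esub> (f x z y \<otimes>\<^bsub>pi1 C\<^esub> f z y x \<otimes>\<^bsub>pi1 C\<^esub> f y x z))"


section \<open>Torsors and biextensions\<close>

record ('a, 'e) torsor =
  pts :: "'e set"
  act :: "'a \<Rightarrow> 'e \<Rightarrow> 'e"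

definition is_torsor :: "('a, 's) monoid_scheme \<Rightarrow> ('a, 'e) torsor \<Rightarrow> bool" where
  "is_torsor A P \<longleftrightarrow>
     pts P \<noteq> {} \<and>
     (\<forall>a \<in> carrier A. \<forall>p \<in> pts P. act P a p \<in> pts P) \<and>
     (\<forall>p \<in> pts P. act P \<one>\<^bsub>A\<^esub> p = p) \<and>
     (\<forall>a \<in> carrier A. \<forall>b \<in> carrier A. \<forall>p \<in> pts P. act P (a \<otimes>\<^bsub>A\<^esub> b) p = act P a (act P b p)) \<and>
     (\<forall>p \<in> pts P. \<forall>q \<in> pts P. \<exists>!a. a \<in> carrier A \<and> act P a p = q)"

text \<open>\<open>wedge A P Q p q\<close> is the class of \<open>(p, q)\<close> in the contracted product of \<open>P\<close> and \<open>Q\<close>.\<close>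

definition wedge ::
  "('a, 's) monoid_scheme \<Rightarrow> ('a, 'p) torsor \<Rightarrow> ('a, 'q) torsor \<Rightarrow> 'p \<Rightarrow> 'q \<Rightarrow> ('p \<times> 'q) set" where
  "wedge A P Q p q = {(act P a p, act Q (inv\<^bsub>A\<^esub> a) q) | a. a \<in> carrier A}"

definition contracted ::
  "('a, 's) monoid_scheme \<Rightarrow> ('a, 'p) torsor \<Rightarrow> ('a, 'q) torsor \<Rightarrow> ('a, ('p \<times> 'q) set) torsor" where
  "contracted A P Q =
     \<lparr>pts = {wedge A P Q p q | p q. p \<in> pts P \<and> q \<in> pts Q},
      act = (\<lambda>a S. (\<lambda>(p, q). (act P a p, q)) ` S)\<rparr>"

definition wedge3 where
  "wedge3 A P Q R p q r = wedge A (contracted A P Q) R (wedge A P Q p q) r"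

definition wedge4 where
  "wedge4 A P Q R S p q r s
     = wedge A (contracted A (contracted A P Q) R) S (wedge3 A P Q R p q r) s"

text \<open>A family of torsors over \<open>B \<times> B\<close> with two partial laws.  The base points are explicit
  arguments of the laws because the underlying sets of different fibres may overlap:
  \<open>add1 E x x' y\<close> goes from \<open>E\<^sub>x\<^sub>,\<^sub>y \<times> E\<^sub>x\<^sub>'\<^sub>,\<^sub>y\<close> to the fibre at \<open>(x + x', y)\<close>, and
  \<open>add2 E x y y'\<close> goes from \<open>E\<^sub>x\<^sub>,\<^sub>y \<times> E\<^sub>x\<^sub>,\<^sub>y\<^sub>'\<close> to the fibre at \<open>(x, y + y')\<close>.\<close>

record ('a, 'b, 'e) biext_data =
  fib :: "'b \<Rightarrow> 'b \<Rightarrow> ('a, 'e) torsor"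
  add1 :: "'b \<Rightarrow> 'b \<Rightarrow> 'b \<Rightarrow> 'e \<Rightarrow> 'e \<Rightarrow> 'e"
  add2 :: "'b \<Rightarrow> 'b \<Rightarrow> 'b \<Rightarrow> 'e \<Rightarrow> 'e \<Rightarrow> 'e"

locale biextension = A: comm_group A + B: comm_group B
  for A :: "('a, 's) monoid_scheme" and B :: "('b, 't) monoid_scheme"
    and E :: "('a, 'b, 'e) biext_data" +
  assumes fib_torsor: "\<lbrakk>x \<in> carrier B; y \<in> carrier B\<rbrakk> \<Longrightarrow> is_torsor A (fib E x y)"
    and add1_closed: "\<lbrakk>x \<in> carrier B; x' \<in> carrier B; y \<in> carrier B;
           u \<in> pts (fib E x y); v \<in> pts (fib E x' y)\<rbrakk>
          \<Longrightarrow> add1 E x x' y u v \<in> pts (fib E (x \<otimes>\<^bsub>B\<^esub> x') y)"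
    and add2_closed: "\<lbrakk>x \<in> carrier B; y \<in> carrier B; y' \<in> carrier B;
           u \<in> pts (fib E x y); w \<in> pts (fib E x y')\<rbrakk>
          \<Longrightarrow> add2 E x y y' u w \<in> pts (fib E x (y \<otimes>\<^bsub>B\<^esub> y'))"
    and add1_morphism: "\<lbrakk>x \<in> carrier B; x' \<in> carrier B; y \<in> carrier B;
           u \<in> pts (fib E x y); v \<in> pts (fib E x' y); a \<in> carrier A; b \<in> carrier A\<rbrakk>
          \<Longrightarrow> add1 E x x' y (act (fib E x y) a u) (act (fib E x' y) b v)
            = act (fib E (x \<otimes>\<^bsub>B\<^esub> x') y) (a \<otimes>\<^bsub>A\<^esub> b) (add1 E x x' y u v)"
    and add2_morphism: "\<lbrakk>x \<in> carrier B; y \<in> carrier B; y' \<in> carrier B;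
           u \<in> pts (fib E x y); w \<in> pts (fib E x y'); a \<in> carrier A; b \<in> carrier A\<rbrakk>
          \<Longrightarrow> add2 E x y y' (act (fib E x y) a u) (act (fib E x y') b w)
            = act (fib E x (y \<otimes>\<^bsub>B\<^esub> y')) (a \<otimes>\<^bsub>A\<^esub> b) (add2 E x y y' u w)"
    and add1_assoc: "\<lbrakk>x \<in> carrier B; x' \<in> carrier B; x'' \<in> carrier B; y \<in> carrier B;
           u \<in> pts (fib E x y); v \<in> pts (fib E x' y); w \<in> pts (fib E x'' y)\<rbrakk>
          \<Longrightarrow> add1 E (x \<otimes>\<^bsub>B\<^esub> x') x'' y (add1 E x x' y u v) w
            = add1 E x (x' \<otimes>\<^bsub>B\<^esub> x'') y u (add1 E x' x'' y v w)"
    and add2_assoc: "\<lbrakk>x \<in> carrier B; y \<in> carrier B; y' \<in> carrier B; y'' \<in> carrier B;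
           u \<in> pts (fib E x y); v \<in> pts (fib E x y'); w \<in> pts (fib E x y'')\<rbrakk>
          \<Longrightarrow> add2 E x (y \<otimes>\<^bsub>B\<^esub> y') y'' (add2 E x y y' u v) w
            = add2 E x y (y' \<otimes>\<^bsub>B\<^esub> y'') u (add2 E x y' y'' v w)"
    and add1_comm: "\<lbrakk>x \<in> carrier B; x' \<in> carrier B; y \<in> carrier B;
           u \<in> pts (fib E x y); v \<in> pts (fib E x' y)\<rbrakk>
          \<Longrightarrow> add1 E x x' y u v = add1 E x' x y v u"
    and add2_comm: "\<lbrakk>x \<in> carrier B; y \<in> carrier B; y' \<in> carrier B;
           u \<in> pts (fib E x y); w \<in> pts (fib E x y')\<rbrakk>
          \<Longrightarrow> add2 E x y y' u w = add2 E x y' y w u"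
    and interchange: "\<lbrakk>x \<in> carrier B; x' \<in> carrier B; y \<in> carrier B; y' \<in> carrier B;
           p \<in> pts (fib E x y); q \<in> pts (fib E x' y); r \<in> pts (fib E x y'); s \<in> pts (fib E x' y')\<rbrakk>
          \<Longrightarrow> add2 E (x \<otimes>\<^bsub>B\<^esub> x') y y' (add1 E x x' y p q) (add1 E x x' y' r s)
            = add1 E x x' (y \<otimes>\<^bsub>B\<^esub> y') (add2 E x y y' p r) (add2 E x' y y' q s)"


section \<open>The \<open>\<Sigma>\<close>-structure on the diagonal\<close>

definition diag :: "('a, 'b, 'e) biext_data \<Rightarrow> 'b \<Rightarrow> ('a, 'e) torsor" where
  "diag E x = fib E x x"

definition zero1 :: "('b, 't) monoid_scheme \<Rightarrow> ('a, 'b, 'e) biext_data \<Rightarrow> 'b \<Rightarrow> 'e" where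
  "zero1 B E y = (THE e. e \<in> pts (fib E \<one>\<^bsub>B\<^esub> y) \<and> add1 E \<one>\<^bsub>B\<^esub> \<one>\<^bsub>B\<^esub> y e e = e)"

definition zero2 :: "('b, 't) monoid_scheme \<Rightarrow> ('a, 'b, 'e) biext_data \<Rightarrow> 'b \<Rightarrow> 'e" where
  "zero2 B E x = (THE e. e \<in> pts (fib E x \<one>\<^bsub>B\<^esub>) \<and> add2 E x \<one>\<^bsub>B\<^esub> \<one>\<^bsub>B\<^esub> e e = e)"

definition neg1 :: "('b, 't) monoid_scheme \<Rightarrow> ('a, 'b, 'e) biext_data \<Rightarrow> 'b \<Rightarrow> 'b \<Rightarrow> 'e \<Rightarrow> 'e" where
  "neg1 B E x y u =
     (THE v. v \<in> pts (fib E (inv\<^bsub>B\<^esub> x) y) \<and> add1 E x (inv\<^bsub>B\<^esub> x) y u v = zero1 B E y)"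

definition neg2 :: "('b, 't) monoid_scheme \<Rightarrow> ('a, 'b, 'e) biext_data \<Rightarrow> 'b \<Rightarrow> 'b \<Rightarrow> 'e \<Rightarrow> 'e" where
  "neg2 B E x y u =
     (THE v. v \<in> pts (fib E x (inv\<^bsub>B\<^esub> y)) \<and> add2 E x y (inv\<^bsub>B\<^esub> y) u v = zero2 B E x)"

text \<open>The symmetry takes \<open>u\<close> in the fibre at \<open>(-x, -x)\<close> to its opposite for both laws in turn.
  It is the isomorphism obtained by putting \<open>y = -x\<close> in the decomposition of the fibre at
  \<open>(x + y, x + y)\<close> below, since the four elements \<open>v\<close>, \<open>neg2 v\<close>, \<open>neg1 v\<close>, \<open>neg1 (neg2 v)\<close>
  add up to the zero element of the fibre at \<open>(0, 0)\<close>.\<close>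

definition symmetry :: "('b, 't) monoid_scheme \<Rightarrow> ('a, 'b, 'e) biext_data \<Rightarrow> 'b \<Rightarrow> 'e \<Rightarrow> 'e" where
  "symmetry B E x u = neg1 B E (inv\<^bsub>B\<^esub> x) x (neg2 B E (inv\<^bsub>B\<^esub> x) (inv\<^bsub>B\<^esub> x) u)"

text \<open>The inverse of the canonical isomorphism from \<open>\<Delta>E\<close> at \<open>x + y\<close> to the contracted product
  of the fibres at \<open>(x, x)\<close>, \<open>(x, y)\<close>, \<open>(y, x)\<close>, \<open>(y, y)\<close>, evaluated on the class of
  \<open>(u\<^sub>x\<^sub>x, u\<^sub>x\<^sub>y, u\<^sub>y\<^sub>x, u\<^sub>y\<^sub>y)\<close>.\<close>

definition diag_sum ::
  "('b, 't) monoid_scheme \<Rightarrow> ('a, 'b, 'e) biext_data \<Rightarrow> 'b \<Rightarrow> 'b \<Rightarrow> 'e \<Rightarrow> 'e \<Rightarrow> 'e \<Rightarrow> 'e \<Rightarrow> 'e" where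
  "diag_sum B E x y uxx uxy uyx uyy =
     add1 E x y (x \<otimes>\<^bsub>B\<^esub> y) (add2 E x x y uxx uxy) (add2 E y x y uyx uyy)"

text \<open>The cube structure: \<open>\<Delta>E\<close> at \<open>x + y + z\<close> is first decomposed along \<open>(x + y) + z\<close>, then the
  fibres at \<open>(x + y, x + y)\<close>, \<open>(x + y, z)\<close> and \<open>(z, x + y)\<close> are decomposed in turn.  Together
  with \<open>\<Delta>E\<close> at \<open>x\<close>, \<open>y\<close> and \<open>z\<close> this yields each diagonal factor twice and each off-diagonal
  factor once, which are regrouped into \<open>\<Delta>E\<close> at \<open>x + y\<close>, \<open>x + z\<close> and \<open>y + z\<close>.  Exchanging the
  two copies of a diagonal factor is the identity on their contracted product, so it does not
  matter which copy goes where.\<close>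

definition cube_iso where
  "cube_iso A B E x y z \<omega> =
     (THE \<omega>'. \<exists>uxx \<in> pts (fib E x x). \<exists>uxy \<in> pts (fib E x y). \<exists>uxz \<in> pts (fib E x z).
              \<exists>uyx \<in> pts (fib E y x). \<exists>uyy \<in> pts (fib E y y). \<exists>uyz \<in> pts (fib E y z).
              \<exists>uzx \<in> pts (fib E z x). \<exists>uzy \<in> pts (fib E z y). \<exists>uzz \<in> pts (fib E z z).
              \<exists>dx \<in> pts (diag E x). \<exists>dy \<in> pts (diag E y). \<exists>dz \<in> pts (diag E z).
        \<omega> = wedge4 A (diag E (x \<otimes>\<^bsub>B\<^esub> y \<otimes>\<^bsub>B\<^esub> z)) (diag E x) (diag E y) (diag E z)
              (diag_sum B E (x \<otimes>\<^bsub>B\<^esub> y) z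
                 (diag_sum B E x y uxx uxy uyx uyy)
                 (add1 E x y z uxz uyz)
                 (add2 E z x y uzx uzy)
                 uzz)
              dx dy dz \<and>
        \<omega>' = wedge3 A (diag E (x \<otimes>\<^bsub>B\<^esub> y)) (diag E (x \<otimes>\<^bsub>B\<^esub> z)) (diag E (y \<otimes>\<^bsub>B\<^esub> z))
               (diag_sum B E x y uxx uxy uyx uyy)
               (diag_sum B E x z dx uxz uzx uzz)
               (diag_sum B E y z dy uyz uzy dz))"

definition alternating_section ::
  "('a, 's) monoid_scheme \<Rightarrow> ('b, 't) monoid_scheme \<Rightarrow> ('a, 'b, 'e) biext_data
    \<Rightarrow> ('b \<Rightarrow> 'e) \<Rightarrow> bool" where
  "alternating_section A B E t \<longleftrightarrow>
     (\<forall>x \<in> carrier B. t x \<in> pts (diag E x)) \<and>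
     (\<forall>x \<in> carrier B. symmetry B E x (t (inv\<^bsub>B\<^esub> x)) = t x) \<and>
     (\<forall>x \<in> carrier B. \<forall>y \<in> carrier B. \<forall>z \<in> carrier B.
        cube_iso A B E x y z
          (wedge4 A (diag E (x \<otimes>\<^bsub>B\<^esub> y \<otimes>\<^bsub>B\<^esub> z)) (diag E x) (diag E y) (diag E z)
             (t (x \<otimes>\<^bsub>B\<^esub> y \<otimes>\<^bsub>B\<^esub> z)) (t x) (t y) (t z))
        = wedge3 A (diag E (x \<otimes>\<^bsub>B\<^esub> y)) (diag E (x \<otimes>\<^bsub>B\<^esub> z)) (diag E (y \<otimes>\<^bsub>B\<^esub> z))
            (t (x \<otimes>\<^bsub>B\<^esub> y)) (t (x \<otimes>\<^bsub>B\<^esub> z)) (t (y \<otimes>\<^bsub>B\<^esub> z)))"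

definition alternating_biextension ::
  "('a, 's) monoid_scheme \<Rightarrow> ('b, 't) monoid_scheme \<Rightarrow> ('a, 'b, 'e) biext_data \<Rightarrow> bool" where
  "alternating_biextension A B E \<longleftrightarrow>
     biextension A B E \<and> (\<exists>t. alternating_section A B E t)"


section \<open>The commutator biextension\<close>

definition commutator ::
  "('o, 'm, 'z) monoidal_data_scheme \<Rightarrow> ('o set \<Rightarrow> 'o) \<Rightarrow> ('o set \<Rightarrow> 'o set \<Rightarrow> 'm)
    \<Rightarrow> ('m, 'o set, 'm) biext_data" where
  "commutator C R c =
     \<lparr>fib = (\<lambda>x y.
        \<lparr>pts = Isom C (R y \<odot>\<^bsub>C\<^esub> R x) (R x \<odot>\<^bsub>C\<^esub> R y),
         act = (\<lambda>a u. left_aut C a (R x \<odot>\<^bsub>C\<^esub> R y) \<cdot>\<^bsub>C\<^esub> u)\<rparr>),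
      add1 = (\<lambda>x x' y u v.
        (c x x' \<boxtimes>\<^bsub>C\<^esub> Id C (R y))
        \<cdot>\<^bsub>C\<^esub> Assoc C (R x) (R x') (R y)
        \<cdot>\<^bsub>C\<^esub> (Id C (R x) \<boxtimes>\<^bsub>C\<^esub> v)
        \<cdot>\<^bsub>C\<^esub> Inv C (Assoc C (R x) (R y) (R x'))
        \<cdot>\<^bsub>C\<^esub> (u \<boxtimes>\<^bsub>C\<^esub> Id C (R x'))
        \<cdot>\<^bsub>C\<^esub> Assoc C (R y) (R x) (R x')
        \<cdot>\<^bsub>C\<^esub> (Id C (R y) \<boxtimes>\<^bsub>C\<^esub> Inv C (c x x'))),
      add2 = (\<lambda>x y y' u w.
        (Id C (R x) \<boxtimes>\<^bsub>C\<^esub> c y y')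
        \<cdot>\<^bsub>C\<^esub> Inv C (Assoc C (R x) (R y) (R y'))
        \<cdot>\<^bsub>C\<^esub> (u \<boxtimes>\<^bsub>C\<^esub> Id C (R y'))
        \<cdot>\<^bsub>C\<^esub> Assoc C (R y) (R x) (R y')
        \<cdot>\<^bsub>C\<^esub> (Id C (R y) \<boxtimes>\<^bsub>C\<^esub> w)
        \<cdot>\<^bsub>C\<^esub> Inv C (Assoc C (R y) (R y') (R x))
        \<cdot>\<^bsub>C\<^esub> (Inv C (c y y') \<boxtimes>\<^bsub>C\<^esub> Id C (R x)))\<rparr>"

end

theory Submission
  imports Defs
begin

text \<open>Trivialize the fibre at \<open>(x, y)\<close> by \<open>s(x, y) = c(x, y)\<inverse> c(y, x)\<close>. In these coordinates the
  first law has the factor set \<open>g(x, x'; y) = f(y, x, x') f(x, x', y) / f(x, y, x')\<close>, and the second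
  law has the inverse of \<open>g(y, y'; x)\<close>. Triviality of the trilinear map says that \<open>g\<close> is symmetric
  in its first two arguments; associativity and the interchange law are sums of cocycle identities
  over shuffles. The alternating section is the identity of \<open>X\<^sub>x X\<^sub>x\<close>, which is \<open>s(x, x)\<close>: the cocycle
  identity at \<open>(x, y, x, y)\<close> gives \<open>g(x, y; x + y) = g(x, y; x) g(x, y; y)\<close>, that is,
  \<open>s(x + y, x + y)\<close> is the sum of \<open>s(x, x)\<close>, \<open>s(x, y)\<close>, \<open>s(y, x)\<close> and \<open>s(y, y)\<close>. As the two factor
  sets are inverse to each other, this is all that the \<open>\<Sigma>\<close>-structure sees.\<close>

section \<open>Torsors under an abelian group\<close>

text \<open>The two factor sets are inverse to each other because the second law passes through the
  associators of the first one backwards, with the roles of the variables exchanged. Associators are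
  not identities, so the composites defining the laws are compared only after composition with the
  arrows \<open>c\<close> into a chosen object. There each associator contributes one value of
  \<open>f\<close> or its inverse and each swap \<open>s\<close> contributes nothing. This requires
  scalars to move freely through composites and through tensor products on either side. Composites
  are handled by naturality, the left factor of a tensor product by a coherence property of the left
  unit that is not among the axioms, and the right factor by the triviality of the action. As
  \<open>c\<close> is not normalized at the zero class, \<open>s\<close> does not take the neutral
  elements of the laws as values. Correction terms such as \<open>g\<close> at two zero arguments
  enter the opposites and have to cancel in the symmetry. The symmetry and the cube isomorphism are
  definite descriptions, so every decomposition of a point must be shown to give the same value. In
  coordinates this amounts to freeness of the action of A.\<close>

context comm_group
begin

lemma torsor_act_closed [simp]:
  "\<lbrakk>is_torsor G P; a \<in> carrier G; p \<in> pts P\<rbrakk> \<Longrightarrow> act P a p \<in> pts P"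
  by (simp add: is_torsor_def)

lemma torsor_act_one [simp]: "\<lbrakk>is_torsor G P; p \<in> pts P\<rbrakk> \<Longrightarrow> act P \<one> p = p"
  by (simp add: is_torsor_def)

lemma torsor_act_act [simp]:
  "\<lbrakk>is_torsor G P; a \<in> carrier G; b \<in> carrier G; p \<in> pts P\<rbrakk>
    \<Longrightarrow> act P a (act P b p) = act P (a \<otimes> b) p"
  by (rule sym) (simp only: is_torsor_def)

lemma torsor_coordinate:
  assumes "is_torsor G P" "p \<in> pts P" "q \<in> pts P"
  obtains a where "a \<in> carrier G" "q = act P a p"
  using assms unfolding is_torsor_def by metis

lemma torsor_act_eq_iff [simp]:
  assumes "is_torsor G P" "p \<in> pts P" "a \<in> carrier G" "b \<in> carrier G"
  shows "act P a p = act P b p \<longleftrightarrow> a = b"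
  using assms unfolding is_torsor_def by metis

lemma torsor_act_eq_self_iff [simp]:
  assumes "is_torsor G P" "p \<in> pts P" "a \<in> carrier G"
  shows "act P a p = p \<longleftrightarrow> a = \<one>"
  using assms torsor_act_eq_iff [of P p a \<one>] by simp

section \<open>Scalars on contracted products\<close>

lemma wedge_in_contracted [simp]:
  "\<lbrakk>p \<in> pts P; q \<in> pts Q\<rbrakk> \<Longrightarrow> wedge G P Q p q \<in> pts (contracted G P Q)"
  by (auto simp: contracted_def)

text \<open>A class is the orbit of a pair under opposite scalars. Shifting the orbit parameter by
  \<open>b\<close> moves the scalar of the second component to the first; commutativity brings the
  result into the form of the orbit.\<close>

lemma wedge_act:
  assumes P: "is_torsor G P" and Q: "is_torsor G Q" and p: "p \<in> pts P" and q: "q \<in> pts Q"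
    and a: "a \<in> carrier G" and b: "b \<in> carrier G"
  shows "wedge G P Q (act P a p) (act Q b q) = act (contracted G P Q) (a \<otimes> b) (wedge G P Q p q)"
proof (intro equalityI subsetI)
  fix z assume "z \<in> wedge G P Q (act P a p) (act Q b q)"
  then obtain x where x: "x \<in> carrier G"
    and z: "z = (act P (x \<otimes> a) p, act Q (inv x \<otimes> b) q)"
    using assms by (auto simp: wedge_def)
  have 1: "x \<otimes> a = a \<otimes> b \<otimes> (x \<otimes> inv b)"
    using x a b by (simp add: m_ac inv_solve_left)
  have 2: "inv x \<otimes> b = inv (x \<otimes> inv b)"
    using x b by (simp add: inv_mult_group m_comm)
  show "z \<in> act (contracted G P Q) (a \<otimes> b) (wedge G P Q p q)"
    unfolding contracted_def wedge_def z 1 2 using assms x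
    by (auto simp: image_iff intro!: exI [of _ "x \<otimes> inv b"])
next
  fix z assume "z \<in> act (contracted G P Q) (a \<otimes> b) (wedge G P Q p q)"
  then obtain x where x: "x \<in> carrier G"
    and z: "z = (act P (a \<otimes> b \<otimes> x) p, act Q (inv x) q)"
    using assms by (auto simp: wedge_def contracted_def)
  have 1: "a \<otimes> b \<otimes> x = x \<otimes> b \<otimes> a"
    using x a b by (simp add: m_ac)
  have 2: "inv x = inv (x \<otimes> b) \<otimes> b"
    using x b by (simp add: inv_mult m_assoc)
  show "z \<in> wedge G P Q (act P a p) (act Q b q)"
    unfolding wedge_def z 1 2 using assms x
    by (auto simp del: inv_mult_group intro!: exI [of _ "x \<otimes> b"])
qed

text \<open>Look at the pair in the orbit whose second component is exactly \<open>q\<close>.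
  Freeness of \<open>Q\<close> forces its orbit parameter to be one, and freeness of
  \<open>P\<close> then compares the scalars.\<close>

lemma contracted_act_eq_iff:
  assumes P: "is_torsor G P" and Q: "is_torsor G Q" and p: "p \<in> pts P" and q: "q \<in> pts Q"
    and a: "a \<in> carrier G" and b: "b \<in> carrier G"
    and eq: "act (contracted G P Q) a (wedge G P Q p q) = act (contracted G P Q) b (wedge G P Q p q)"
  shows "a = b"
proof -
  have act: "act (contracted G P Q) d (wedge G P Q p q)
      = {(act P (d \<otimes> x) p, act Q (inv x) q) | x. x \<in> carrier G}" if "d \<in> carrier G" for d
    using that P p by (fastforce simp: contracted_def wedge_def image_iff)
  have "(act P a p, q) \<in> act (contracted G P Q) a (wedge G P Q p q)"
    unfolding act [OF a] using a Q q by (intro CollectI exI [of _ \<one>]) simp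
  then obtain x where x: "x \<in> carrier G" and *: "act P a p = act P (b \<otimes> x) p" "q = act Q (inv x) q"
    unfolding eq act [OF b] by blast
  have "inv x = \<one>"
    using * x torsor_act_eq_self_iff [OF Q q, of "inv x"] by auto
  then have "x = \<one>"
    using x by simp
  then show ?thesis
    using * P p a b by simp
qed

lemma contracted_torsor [simp]:
  assumes P: "is_torsor G P" and Q: "is_torsor G Q"
  shows "is_torsor G (contracted G P Q)"
proof -
  let ?T = "contracted G P Q"
  have pts: "w \<in> pts ?T \<longleftrightarrow> (\<exists>p \<in> pts P. \<exists>q \<in> pts Q. w = wedge G P Q p q)" for w
    by (auto simp: contracted_def)
  have act: "act ?T a (wedge G P Q p q) = wedge G P Q (act P a p) q"
    if "a \<in> carrier G" "p \<in> pts P" "q \<in> pts Q" for a p q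
    using wedge_act [OF P Q that(2,3,1) one_closed] that Q by simp
  have ex: "\<exists>!a. a \<in> carrier G \<and> act ?T a w = w'" if "w \<in> pts ?T" "w' \<in> pts ?T" for w w'
  proof -
    obtain p q where w: "p \<in> pts P" "q \<in> pts Q" "w = wedge G P Q p q"
      using \<open>w \<in> pts ?T\<close> pts by blast
    obtain p' q' where w': "p' \<in> pts P" "q' \<in> pts Q" "w' = wedge G P Q p' q'"
      using \<open>w' \<in> pts ?T\<close> pts by blast
    obtain a where a: "a \<in> carrier G" "p' = act P a p"
      using torsor_coordinate [OF P w(1) w'(1)] by blast
    obtain b where b: "b \<in> carrier G" "q' = act Q b q"
      using torsor_coordinate [OF Q w(2) w'(2)] by blast
    \<comment> \<open>Transitivity: the two coordinate differences \<open>a\<close> and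
      \<open>b\<close> merge into a single scalar.\<close>
    have "act ?T (a \<otimes> b) w = w'"
      unfolding w w' a b using wedge_act [OF P Q w(1,2) a(1) b(1)] by simp
    moreover have "d = e" if "d \<in> carrier G" "e \<in> carrier G" "act ?T d w = act ?T e w" for d e
      using contracted_act_eq_iff [OF P Q w(1,2)] that unfolding w by blast
    ultimately show ?thesis
      using a b by (metis m_closed)
  qed
  have "pts P \<noteq> {}" "pts Q \<noteq> {}"
    using P [unfolded is_torsor_def, THEN conjunct1] Q [unfolded is_torsor_def, THEN conjunct1] .
  then have "pts ?T \<noteq> {}"
    using pts by blast
  moreover have laws: "act ?T a w \<in> pts ?T \<and> act ?T \<one> w = w
      \<and> act ?T (a \<otimes> b) w = act ?T a (act ?T b w)"
    if a: "a \<in> carrier G" and b: "b \<in> carrier G" and "w \<in> pts ?T" for a b w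
  proof -
    obtain p q where "p \<in> pts P" "q \<in> pts Q" "w = wedge G P Q p q"
      using \<open>w \<in> pts ?T\<close> pts by blast
    then show ?thesis
      using a b P by (simp add: act)
  qed
  ultimately show ?thesis
    unfolding is_torsor_def using laws [OF one_closed one_closed] laws ex
    by (intro conjI ballI) simp_all
qed

text \<open>Only the product of the scalars survives, so that points of iterated contracted products
  can be compared through one element of the group.\<close>

lemma wedge3_act:
  assumes "is_torsor G P" "is_torsor G Q" "is_torsor G R"
    and "p \<in> pts P" "q \<in> pts Q" "r \<in> pts R"
    and "a \<in> carrier G" "b \<in> carrier G" "d \<in> carrier G"
  shows "wedge3 G P Q R (act P a p) (act Q b q) (act R d r)
    = act (contracted G (contracted G P Q) R) (a \<otimes> b \<otimes> d) (wedge3 G P Q R p q r)"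
  using assms by (simp add: wedge3_def wedge_act)

lemma wedge4_act:
  assumes "is_torsor G P" "is_torsor G Q" "is_torsor G R" "is_torsor G S"
    and "p \<in> pts P" "q \<in> pts Q" "r \<in> pts R" "s \<in> pts S"
    and "a \<in> carrier G" "b \<in> carrier G" "d \<in> carrier G" "e \<in> carrier G"
  shows "wedge4 G P Q R S (act P a p) (act Q b q) (act R d r) (act S e s)
    = act (contracted G (contracted G (contracted G P Q) R) S)
        (a \<otimes> b \<otimes> d \<otimes> e) (wedge4 G P Q R S p q r s)"
  using assms by (simp add: wedge4_def wedge_act wedge3_act) (simp add: wedge3_def wedge_act)

end

section \<open>Alternating biextensions from factor sets\<close>

text \<open>The point \<open>s x y\<close> identifies the fibre at \<open>(x, y)\<close> with \<open>A\<close>; the factor set of the first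
  law is then \<open>g\<close> and that of the second law its inverse with exchanged arguments, so that the
  biextension is antisymmetric.\<close>

locale antisymmetric_factor_set = A: comm_group A + B: comm_group B
  for A :: "('a, 's) monoid_scheme" and B :: "('b, 't) monoid_scheme"
    and E :: "('a, 'b, 'e) biext_data"
    and s :: "'b \<Rightarrow> 'b \<Rightarrow> 'e" and g :: "'b \<Rightarrow> 'b \<Rightarrow> 'b \<Rightarrow> 'a" +
  assumes fib_torsor [simp]: "\<lbrakk>x \<in> carrier B; y \<in> carrier B\<rbrakk> \<Longrightarrow> is_torsor A (fib E x y)"
    and s_closed [simp]: "\<lbrakk>x \<in> carrier B; y \<in> carrier B\<rbrakk> \<Longrightarrow> s x y \<in> pts (fib E x y)"
    and g_closed [simp]: "\<lbrakk>x \<in> carrier B; y \<in> carrier B; z \<in> carrier B\<rbrakk> \<Longrightarrow> g x y z \<in> carrier A"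
    and add1_act: "\<lbrakk>x \<in> carrier B; x' \<in> carrier B; y \<in> carrier B; a \<in> carrier A; b \<in> carrier A\<rbrakk>
        \<Longrightarrow> add1 E x x' y (act (fib E x y) a (s x y)) (act (fib E x' y) b (s x' y))
          = act (fib E (x \<otimes>\<^bsub>B\<^esub> x') y) (a \<otimes>\<^bsub>A\<^esub> b \<otimes>\<^bsub>A\<^esub> g x x' y) (s (x \<otimes>\<^bsub>B\<^esub> x') y)"
    and add2_act: "\<lbrakk>x \<in> carrier B; y \<in> carrier B; y' \<in> carrier B; a \<in> carrier A; b \<in> carrier A\<rbrakk>
        \<Longrightarrow> add2 E x y y' (act (fib E x y) a (s x y)) (act (fib E x y') b (s x y'))
          = act (fib E x (y \<otimes>\<^bsub>B\<^esub> y')) (a \<otimes>\<^bsub>A\<^esub> b \<otimes>\<^bsub>A\<^esub> inv\<^bsub>A\<^esub> g y y' x) (s x (y \<otimes>\<^bsub>B\<^esub> y'))"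
    and g_comm: "\<lbrakk>x \<in> carrier B; y \<in> carrier B; z \<in> carrier B\<rbrakk> \<Longrightarrow> g x y z = g y x z"
    and g_cocycle: "\<lbrakk>x \<in> carrier B; x' \<in> carrier B; x'' \<in> carrier B; y \<in> carrier B\<rbrakk>
        \<Longrightarrow> g x x' y \<otimes>\<^bsub>A\<^esub> g (x \<otimes>\<^bsub>B\<^esub> x') x'' y = g x' x'' y \<otimes>\<^bsub>A\<^esub> g x (x' \<otimes>\<^bsub>B\<^esub> x'') y"
    and g_interchange: "\<lbrakk>x \<in> carrier B; x' \<in> carrier B; y \<in> carrier B; y' \<in> carrier B\<rbrakk>
        \<Longrightarrow> g x x' y \<otimes>\<^bsub>A\<^esub> g x x' y' \<otimes>\<^bsub>A\<^esub> (g y y' x \<otimes>\<^bsub>A\<^esub> g y y' x')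
          = g x x' (y \<otimes>\<^bsub>B\<^esub> y') \<otimes>\<^bsub>A\<^esub> g y y' (x \<otimes>\<^bsub>B\<^esub> x')"
    and g_diagonal: "\<lbrakk>x \<in> carrier B; y \<in> carrier B\<rbrakk>
        \<Longrightarrow> g x y (x \<otimes>\<^bsub>B\<^esub> y) = g x y x \<otimes>\<^bsub>A\<^esub> g x y y"
begin

section \<open>The biextension axioms in coordinates\<close>

lemma fib_coordinate:
  assumes "u \<in> pts (fib E x y)" "x \<in> carrier B" "y \<in> carrier B"
  obtains a where "a \<in> carrier A" "u = act (fib E x y) a (s x y)"
  using A.torsor_coordinate [of "fib E x y" "s x y" u] assms by auto

text \<open>This is \<open>g_interchange\<close> in the shape that the interchange law takes after
  evaluation, where the contributions of \<open>add2\<close> appear inverted.\<close>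

lemma interchange_coordinates:
  assumes "x \<in> carrier B" "x' \<in> carrier B" "y \<in> carrier B" "y' \<in> carrier B"
  shows "g x x' y \<otimes>\<^bsub>A\<^esub> g x x' y' \<otimes>\<^bsub>A\<^esub> inv\<^bsub>A\<^esub> g y y' (x \<otimes>\<^bsub>B\<^esub> x')
    = inv\<^bsub>A\<^esub> g y y' x \<otimes>\<^bsub>A\<^esub> inv\<^bsub>A\<^esub> g y y' x' \<otimes>\<^bsub>A\<^esub> g x x' (y \<otimes>\<^bsub>B\<^esub> y')"
proof -
  have aux: "p \<otimes>\<^bsub>A\<^esub> inv\<^bsub>A\<^esub> q = inv\<^bsub>A\<^esub> u \<otimes>\<^bsub>A\<^esub> inv\<^bsub>A\<^esub> v \<otimes>\<^bsub>A\<^esub> w"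
    if "p \<otimes>\<^bsub>A\<^esub> (u \<otimes>\<^bsub>A\<^esub> v) = w \<otimes>\<^bsub>A\<^esub> q" "p \<in> carrier A" "q \<in> carrier A" "u \<in> carrier A"
      "v \<in> carrier A" "w \<in> carrier A" for p q u v w
  proof -
    have "p \<otimes>\<^bsub>A\<^esub> inv\<^bsub>A\<^esub> q = (u \<otimes>\<^bsub>A\<^esub> inv\<^bsub>A\<^esub> u) \<otimes>\<^bsub>A\<^esub> (v \<otimes>\<^bsub>A\<^esub> inv\<^bsub>A\<^esub> v) \<otimes>\<^bsub>A\<^esub> (p \<otimes>\<^bsub>A\<^esub> inv\<^bsub>A\<^esub> q)"
      using that by simp
    also have "\<dots> = inv\<^bsub>A\<^esub> u \<otimes>\<^bsub>A\<^esub> inv\<^bsub>A\<^esub> v \<otimes>\<^bsub>A\<^esub> (p \<otimes>\<^bsub>A\<^esub> (u \<otimes>\<^bsub>A\<^esub> v)) \<otimes>\<^bsub>A\<^esub> inv\<^bsub>A\<^esub> q"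
      using that(2-) by (simp only: A.m_ac A.m_closed A.inv_closed)
    also have "\<dots> = inv\<^bsub>A\<^esub> u \<otimes>\<^bsub>A\<^esub> inv\<^bsub>A\<^esub> v \<otimes>\<^bsub>A\<^esub> w"
      unfolding that(1) using that(2-) by (simp add: A.m_assoc)
    finally show ?thesis .
  qed
  show ?thesis
    using aux [OF g_interchange [OF assms]] assms by simp
qed

text \<open>Once every point is a scalar times \<open>s\<close>, each axiom becomes an identity
  between coefficients: \<open>g_comm\<close> for commutativity, \<open>g_cocycle\<close> for
  associativity, and \<open>interchange_coordinates\<close> for the compatibility of the two
  laws.\<close>

sublocale biextension A B E
proof
  fix x x' y u v a b
  assume *: "x \<in> carrier B" "x' \<in> carrier B" "y \<in> carrier B"
    "u \<in> pts (fib E x y)" "v \<in> pts (fib E x' y)"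
  obtain d where d: "d \<in> carrier A" "u = act (fib E x y) d (s x y)"
    using fib_coordinate * by blast
  obtain e where e: "e \<in> carrier A" "v = act (fib E x' y) e (s x' y)"
    using fib_coordinate * by blast
  show "add1 E x x' y u v \<in> pts (fib E (x \<otimes>\<^bsub>B\<^esub> x') y)"
    using * d e by (simp add: add1_act)
  show "add1 E x x' y u v = add1 E x' x y v u"
    using * d e by (simp add: add1_act A.m_comm B.m_comm g_comm)
  assume "a \<in> carrier A" "b \<in> carrier A"
  then show "add1 E x x' y (act (fib E x y) a u) (act (fib E x' y) b v)
      = act (fib E (x \<otimes>\<^bsub>B\<^esub> x') y) (a \<otimes>\<^bsub>A\<^esub> b) (add1 E x x' y u v)"
    using * d e by (simp add: add1_act A.m_ac)
next
  fix x y y' u w a b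
  assume *: "x \<in> carrier B" "y \<in> carrier B" "y' \<in> carrier B"
    "u \<in> pts (fib E x y)" "w \<in> pts (fib E x y')"
  obtain d where d: "d \<in> carrier A" "u = act (fib E x y) d (s x y)"
    using fib_coordinate * by blast
  obtain e where e: "e \<in> carrier A" "w = act (fib E x y') e (s x y')"
    using fib_coordinate * by blast
  show "add2 E x y y' u w \<in> pts (fib E x (y \<otimes>\<^bsub>B\<^esub> y'))"
    using * d e by (simp add: add2_act)
  show "add2 E x y y' u w = add2 E x y' y w u"
    using * d e by (simp add: add2_act A.m_comm B.m_comm g_comm)
  assume "a \<in> carrier A" "b \<in> carrier A"
  then show "add2 E x y y' (act (fib E x y) a u) (act (fib E x y') b w)
      = act (fib E x (y \<otimes>\<^bsub>B\<^esub> y')) (a \<otimes>\<^bsub>A\<^esub> b) (add2 E x y y' u w)"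
    using * d e by (simp add: add2_act A.m_ac)
next
  fix x x' x'' y u v w
  assume *: "x \<in> carrier B" "x' \<in> carrier B" "x'' \<in> carrier B" "y \<in> carrier B"
    "u \<in> pts (fib E x y)" "v \<in> pts (fib E x' y)" "w \<in> pts (fib E x'' y)"
  obtain d where d: "d \<in> carrier A" "u = act (fib E x y) d (s x y)"
    using fib_coordinate * by blast
  obtain e where e: "e \<in> carrier A" "v = act (fib E x' y) e (s x' y)"
    using fib_coordinate * by blast
  obtain i where i: "i \<in> carrier A" "w = act (fib E x'' y) i (s x'' y)"
    using fib_coordinate * by blast
  show "add1 E (x \<otimes>\<^bsub>B\<^esub> x') x'' y (add1 E x x' y u v) w
      = add1 E x (x' \<otimes>\<^bsub>B\<^esub> x'') y u (add1 E x' x'' y v w)"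
    using * d e i g_cocycle [of x x' x'' y] by (simp add: add1_act A.m_ac B.m_assoc)
next
  fix x y y' y'' u v w
  assume *: "x \<in> carrier B" "y \<in> carrier B" "y' \<in> carrier B" "y'' \<in> carrier B"
    "u \<in> pts (fib E x y)" "v \<in> pts (fib E x y')" "w \<in> pts (fib E x y'')"
  obtain d where d: "d \<in> carrier A" "u = act (fib E x y) d (s x y)"
    using fib_coordinate * by blast
  obtain e where e: "e \<in> carrier A" "v = act (fib E x y') e (s x y')"
    using fib_coordinate * by blast
  obtain i where i: "i \<in> carrier A" "w = act (fib E x y'') i (s x y'')"
    using fib_coordinate * by blast
  have "inv\<^bsub>A\<^esub> g y y' x \<otimes>\<^bsub>A\<^esub> inv\<^bsub>A\<^esub> g (y \<otimes>\<^bsub>B\<^esub> y') y'' x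
      = inv\<^bsub>A\<^esub> g y' y'' x \<otimes>\<^bsub>A\<^esub> inv\<^bsub>A\<^esub> g y (y' \<otimes>\<^bsub>B\<^esub> y'') x"
    using * g_cocycle [of y y' y'' x] by (simp flip: A.inv_mult)
  then show "add2 E x (y \<otimes>\<^bsub>B\<^esub> y') y'' (add2 E x y y' u v) w
      = add2 E x y (y' \<otimes>\<^bsub>B\<^esub> y'') u (add2 E x y' y'' v w)"
    using * d e i by (simp add: add2_act A.m_ac B.m_assoc)
next
  fix x x' y y' p q r t
  assume *: "x \<in> carrier B" "x' \<in> carrier B" "y \<in> carrier B" "y' \<in> carrier B"
    "p \<in> pts (fib E x y)" "q \<in> pts (fib E x' y)" "r \<in> pts (fib E x y')" "t \<in> pts (fib E x' y')"
  obtain d where d: "d \<in> carrier A" "p = act (fib E x y) d (s x y)"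
    using fib_coordinate * by blast
  obtain e where e: "e \<in> carrier A" "q = act (fib E x' y) e (s x' y)"
    using fib_coordinate * by blast
  obtain i where i: "i \<in> carrier A" "r = act (fib E x y') i (s x y')"
    using fib_coordinate * by blast
  obtain j where j: "j \<in> carrier A" "t = act (fib E x' y') j (s x' y')"
    using fib_coordinate * by blast
  show "add2 E (x \<otimes>\<^bsub>B\<^esub> x') y y' (add1 E x x' y p q) (add1 E x x' y' r t)
      = add1 E x x' (y \<otimes>\<^bsub>B\<^esub> y') (add2 E x y y' p r) (add2 E x' y y' q t)"
    using * d e i j interchange_coordinates [of x x' y y']
    by (simp add: add1_act add2_act A.m_ac)
qed simp

section \<open>The \<Sigma>-structure in coordinates\<close>

text \<open>The two inner sums contribute the inverses of \<open>g x y x\<close> and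
  \<open>g x y y\<close>, the outer sum contributes \<open>g x y (x + y)\<close>, and by
  \<open>g_diagonal\<close> these cancel. Hence the decomposition of the diagonal only multiplies
  coordinates.\<close>

lemma diag_sum_act:
  assumes "x \<in> carrier B" "y \<in> carrier B"
    "a \<in> carrier A" "b \<in> carrier A" "d \<in> carrier A" "e \<in> carrier A"
  shows "diag_sum B E x y (act (fib E x x) a (s x x)) (act (fib E x y) b (s x y))
      (act (fib E y x) d (s y x)) (act (fib E y y) e (s y y))
    = act (fib E (x \<otimes>\<^bsub>B\<^esub> y) (x \<otimes>\<^bsub>B\<^esub> y)) (a \<otimes>\<^bsub>A\<^esub> b \<otimes>\<^bsub>A\<^esub> d \<otimes>\<^bsub>A\<^esub> e)
        (s (x \<otimes>\<^bsub>B\<^esub> y) (x \<otimes>\<^bsub>B\<^esub> y))"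
proof -
  have aux: "a \<otimes>\<^bsub>A\<^esub> b \<otimes>\<^bsub>A\<^esub> inv\<^bsub>A\<^esub> p \<otimes>\<^bsub>A\<^esub> (d \<otimes>\<^bsub>A\<^esub> e \<otimes>\<^bsub>A\<^esub> inv\<^bsub>A\<^esub> q) \<otimes>\<^bsub>A\<^esub> (p \<otimes>\<^bsub>A\<^esub> q)
      = a \<otimes>\<^bsub>A\<^esub> b \<otimes>\<^bsub>A\<^esub> d \<otimes>\<^bsub>A\<^esub> e"
    if "p \<in> carrier A" "q \<in> carrier A" for p q
  proof -
    have "a \<otimes>\<^bsub>A\<^esub> b \<otimes>\<^bsub>A\<^esub> inv\<^bsub>A\<^esub> p \<otimes>\<^bsub>A\<^esub> (d \<otimes>\<^bsub>A\<^esub> e \<otimes>\<^bsub>A\<^esub> inv\<^bsub>A\<^esub> q) \<otimes>\<^bsub>A\<^esub> (p \<otimes>\<^bsub>A\<^esub> q)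
        = a \<otimes>\<^bsub>A\<^esub> b \<otimes>\<^bsub>A\<^esub> d \<otimes>\<^bsub>A\<^esub> e \<otimes>\<^bsub>A\<^esub> ((p \<otimes>\<^bsub>A\<^esub> inv\<^bsub>A\<^esub> p) \<otimes>\<^bsub>A\<^esub> (q \<otimes>\<^bsub>A\<^esub> inv\<^bsub>A\<^esub> q))"
      using assms that by (simp only: A.m_ac A.m_closed A.inv_closed)
    then show ?thesis
      using assms that by simp
  qed
  show ?thesis
    using assms by (simp add: diag_sum_def add1_act add2_act g_diagonal aux)
qed

text \<open>At zero the diagonal identity says that this element is idempotent.\<close>

lemma g_one: "g \<one>\<^bsub>B\<^esub> \<one>\<^bsub>B\<^esub> \<one>\<^bsub>B\<^esub> = \<one>\<^bsub>A\<^esub>"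
  using g_diagonal [of "\<one>\<^bsub>B\<^esub>" "\<one>\<^bsub>B\<^esub>"] by simp

text \<open>The coordinate \<open>a\<close> of a neutral element solves \<open>a a g = a\<close>; it
  differs from one as far as \<open>g\<close> fails to be normalized at zero. For the second law the
  factor set, and hence the solution, is inverted.\<close>

lemma zero1_eq:
  assumes "y \<in> carrier B"
  shows "zero1 B E y = act (fib E \<one>\<^bsub>B\<^esub> y) (inv\<^bsub>A\<^esub> g \<one>\<^bsub>B\<^esub> \<one>\<^bsub>B\<^esub> y) (s \<one>\<^bsub>B\<^esub> y)"
  unfolding zero1_def
proof (rule the_equality, goal_cases)
  case 1
  show ?case
    using assms add1_act [of "\<one>\<^bsub>B\<^esub>" "\<one>\<^bsub>B\<^esub>" y] by (simp add: A.m_assoc)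
next
  case (2 e)
  then obtain a where a: "a \<in> carrier A" "e = act (fib E \<one>\<^bsub>B\<^esub> y) a (s \<one>\<^bsub>B\<^esub> y)"
    using fib_coordinate [of e "\<one>\<^bsub>B\<^esub>" y] assms by auto
  have "a \<otimes>\<^bsub>A\<^esub> g \<one>\<^bsub>B\<^esub> \<one>\<^bsub>B\<^esub> y = \<one>\<^bsub>A\<^esub>"
    using 2 a assms add1_act [of "\<one>\<^bsub>B\<^esub>" "\<one>\<^bsub>B\<^esub>" y a a] by (simp add: A.m_assoc)
  then show ?case
    using a assms A.inv_equality by (metis A.inv_inv B.one_closed g_closed A.m_comm)
qed

lemma zero2_eq:
  assumes "x \<in> carrier B"
  shows "zero2 B E x = act (fib E x \<one>\<^bsub>B\<^esub>) (g \<one>\<^bsub>B\<^esub> \<one>\<^bsub>B\<^esub> x) (s x \<one>\<^bsub>B\<^esub>)"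
  unfolding zero2_def
proof (rule the_equality, goal_cases)
  case 1
  show ?case
    using assms add2_act [of x "\<one>\<^bsub>B\<^esub>" "\<one>\<^bsub>B\<^esub>"] by (simp add: A.m_assoc)
next
  case (2 e)
  then obtain a where a: "a \<in> carrier A" "e = act (fib E x \<one>\<^bsub>B\<^esub>) a (s x \<one>\<^bsub>B\<^esub>)"
    using fib_coordinate [of e x "\<one>\<^bsub>B\<^esub>"] assms by auto
  have "a \<otimes>\<^bsub>A\<^esub> inv\<^bsub>A\<^esub> g \<one>\<^bsub>B\<^esub> \<one>\<^bsub>B\<^esub> x = \<one>\<^bsub>A\<^esub>"
    using 2 a assms add2_act [of x "\<one>\<^bsub>B\<^esub>" "\<one>\<^bsub>B\<^esub>" a a] by (simp add: A.m_assoc)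
  then show ?case
    using a assms by (metis A.inv_closed A.inv_equality A.inv_inv B.one_closed g_closed)
qed

lemma neg1_act:
  assumes "x \<in> carrier B" "y \<in> carrier B" "a \<in> carrier A"
  shows "neg1 B E x y (act (fib E x y) a (s x y))
    = act (fib E (inv\<^bsub>B\<^esub> x) y)
        (inv\<^bsub>A\<^esub> (a \<otimes>\<^bsub>A\<^esub> g x (inv\<^bsub>B\<^esub> x) y \<otimes>\<^bsub>A\<^esub> g \<one>\<^bsub>B\<^esub> \<one>\<^bsub>B\<^esub> y)) (s (inv\<^bsub>B\<^esub> x) y)"
  unfolding neg1_def
proof (rule the_equality, goal_cases)
  case 1
  have "a \<otimes>\<^bsub>A\<^esub> inv\<^bsub>A\<^esub> (a \<otimes>\<^bsub>A\<^esub> g x (inv\<^bsub>B\<^esub> x) y \<otimes>\<^bsub>A\<^esub> g \<one>\<^bsub>B\<^esub> \<one>\<^bsub>B\<^esub> y) \<otimes>\<^bsub>A\<^esub> g x (inv\<^bsub>B\<^esub> x) y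
      = (a \<otimes>\<^bsub>A\<^esub> inv\<^bsub>A\<^esub> a) \<otimes>\<^bsub>A\<^esub> (g x (inv\<^bsub>B\<^esub> x) y \<otimes>\<^bsub>A\<^esub> inv\<^bsub>A\<^esub> g x (inv\<^bsub>B\<^esub> x) y)
          \<otimes>\<^bsub>A\<^esub> inv\<^bsub>A\<^esub> g \<one>\<^bsub>B\<^esub> \<one>\<^bsub>B\<^esub> y"
    using assms
    by (simp only: A.inv_mult A.m_ac A.m_closed A.inv_closed g_closed B.inv_closed B.one_closed)
  then show ?case
    using assms add1_act [of x "inv\<^bsub>B\<^esub> x" y] by (simp add: zero1_eq)
next
  case (2 v)
  then obtain b where b: "b \<in> carrier A" "v = act (fib E (inv\<^bsub>B\<^esub> x) y) b (s (inv\<^bsub>B\<^esub> x) y)"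
    using fib_coordinate [of v "inv\<^bsub>B\<^esub> x" y] assms by auto
  have *: "a \<otimes>\<^bsub>A\<^esub> b \<otimes>\<^bsub>A\<^esub> g x (inv\<^bsub>B\<^esub> x) y = inv\<^bsub>A\<^esub> g \<one>\<^bsub>B\<^esub> \<one>\<^bsub>B\<^esub> y"
    using 2 b assms add1_act [of x "inv\<^bsub>B\<^esub> x" y a b] by (simp add: zero1_eq)
  have "b \<otimes>\<^bsub>A\<^esub> (a \<otimes>\<^bsub>A\<^esub> g x (inv\<^bsub>B\<^esub> x) y \<otimes>\<^bsub>A\<^esub> g \<one>\<^bsub>B\<^esub> \<one>\<^bsub>B\<^esub> y)
      = a \<otimes>\<^bsub>A\<^esub> b \<otimes>\<^bsub>A\<^esub> g x (inv\<^bsub>B\<^esub> x) y \<otimes>\<^bsub>A\<^esub> g \<one>\<^bsub>B\<^esub> \<one>\<^bsub>B\<^esub> y"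
    using assms b by (simp add: A.m_ac)
  also have "\<dots> = \<one>\<^bsub>A\<^esub>"
    unfolding * using assms by simp
  finally show ?case
    using b assms by (metis A.inv_equality A.m_closed B.inv_closed B.one_closed g_closed)
qed

lemma neg2_act:
  assumes "x \<in> carrier B" "y \<in> carrier B" "a \<in> carrier A"
  shows "neg2 B E x y (act (fib E x y) a (s x y))
    = act (fib E x (inv\<^bsub>B\<^esub> y))
        (inv\<^bsub>A\<^esub> a \<otimes>\<^bsub>A\<^esub> g y (inv\<^bsub>B\<^esub> y) x \<otimes>\<^bsub>A\<^esub> g \<one>\<^bsub>B\<^esub> \<one>\<^bsub>B\<^esub> x) (s x (inv\<^bsub>B\<^esub> y))"
  unfolding neg2_def
proof (rule the_equality, goal_cases)
  case 1
  have "a \<otimes>\<^bsub>A\<^esub> (inv\<^bsub>A\<^esub> a \<otimes>\<^bsub>A\<^esub> g y (inv\<^bsub>B\<^esub> y) x \<otimes>\<^bsub>A\<^esub> g \<one>\<^bsub>B\<^esub> \<one>\<^bsub>B\<^esub> x) \<otimes>\<^bsub>A\<^esub> inv\<^bsub>A\<^esub> g y (inv\<^bsub>B\<^esub> y) x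
      = (a \<otimes>\<^bsub>A\<^esub> inv\<^bsub>A\<^esub> a) \<otimes>\<^bsub>A\<^esub> (g y (inv\<^bsub>B\<^esub> y) x \<otimes>\<^bsub>A\<^esub> inv\<^bsub>A\<^esub> g y (inv\<^bsub>B\<^esub> y) x)
          \<otimes>\<^bsub>A\<^esub> g \<one>\<^bsub>B\<^esub> \<one>\<^bsub>B\<^esub> x"
    using assms
    by (simp only: A.inv_mult A.m_ac A.m_closed A.inv_closed g_closed B.inv_closed B.one_closed)
  then show ?case
    using assms add2_act [of x y "inv\<^bsub>B\<^esub> y"] by (simp add: zero2_eq)
next
  case (2 v)
  then obtain b where b: "b \<in> carrier A" "v = act (fib E x (inv\<^bsub>B\<^esub> y)) b (s x (inv\<^bsub>B\<^esub> y))"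
    using fib_coordinate [of v x "inv\<^bsub>B\<^esub> y"] assms by auto
  have *: "a \<otimes>\<^bsub>A\<^esub> b \<otimes>\<^bsub>A\<^esub> inv\<^bsub>A\<^esub> g y (inv\<^bsub>B\<^esub> y) x = g \<one>\<^bsub>B\<^esub> \<one>\<^bsub>B\<^esub> x"
    using 2 b assms add2_act [of x y "inv\<^bsub>B\<^esub> y" a b] by (simp add: zero2_eq)
  have "b = (a \<otimes>\<^bsub>A\<^esub> inv\<^bsub>A\<^esub> a) \<otimes>\<^bsub>A\<^esub> (g y (inv\<^bsub>B\<^esub> y) x \<otimes>\<^bsub>A\<^esub> inv\<^bsub>A\<^esub> g y (inv\<^bsub>B\<^esub> y) x) \<otimes>\<^bsub>A\<^esub> b"
    using b assms by simp
  also have "\<dots> = inv\<^bsub>A\<^esub> a \<otimes>\<^bsub>A\<^esub> g y (inv\<^bsub>B\<^esub> y) x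
      \<otimes>\<^bsub>A\<^esub> (a \<otimes>\<^bsub>A\<^esub> b \<otimes>\<^bsub>A\<^esub> inv\<^bsub>A\<^esub> g y (inv\<^bsub>B\<^esub> y) x)"
    using assms b by (simp only: A.m_ac A.m_closed A.inv_closed g_closed B.inv_closed B.one_closed)
  finally show ?case
    unfolding * b by simp
qed

text \<open>The two opposites produce the inverse of g(-x,x;-x) g(0,0;-x) g(-x,x;x) g(0,0;x). The
  diagonal identity at (-x, x) merges the first and third factors into g(-x,x;0), and interchange at
  zero arguments disposes of the rest.\<close>

lemma symmetry_s:
  assumes x: "x \<in> carrier B"
  shows "symmetry B E x (s (inv\<^bsub>B\<^esub> x) (inv\<^bsub>B\<^esub> x)) = s x x"
proof -
  let ?x = "inv\<^bsub>B\<^esub> x"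
  have "g ?x x \<one>\<^bsub>B\<^esub> \<otimes>\<^bsub>A\<^esub> (g \<one>\<^bsub>B\<^esub> \<one>\<^bsub>B\<^esub> ?x \<otimes>\<^bsub>A\<^esub> g \<one>\<^bsub>B\<^esub> \<one>\<^bsub>B\<^esub> x) = \<one>\<^bsub>A\<^esub>"
  proof -
    have "g ?x x \<one>\<^bsub>B\<^esub> \<otimes>\<^bsub>A\<^esub> g ?x x \<one>\<^bsub>B\<^esub> \<otimes>\<^bsub>A\<^esub> (g \<one>\<^bsub>B\<^esub> \<one>\<^bsub>B\<^esub> ?x \<otimes>\<^bsub>A\<^esub> g \<one>\<^bsub>B\<^esub> \<one>\<^bsub>B\<^esub> x)
        = g ?x x \<one>\<^bsub>B\<^esub>"
      \<comment> \<open>With both last arguments zero, the right-hand side is g(-x,x;0) g(0,0;0),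
        which is g(-x,x;0) by \<open>g_one\<close>; one copy of it cancels against the square on the
        left.\<close>
      using g_interchange [of ?x x "\<one>\<^bsub>B\<^esub>" "\<one>\<^bsub>B\<^esub>"] x by (simp add: g_one)
    then show ?thesis
      using x by (simp add: A.m_assoc)
  qed
  then have *: "g ?x x ?x \<otimes>\<^bsub>A\<^esub> g \<one>\<^bsub>B\<^esub> \<one>\<^bsub>B\<^esub> ?x \<otimes>\<^bsub>A\<^esub> g ?x x x \<otimes>\<^bsub>A\<^esub> g \<one>\<^bsub>B\<^esub> \<one>\<^bsub>B\<^esub> x = \<one>\<^bsub>A\<^esub>"
    using g_diagonal [of ?x x] x by (simp add: A.m_ac)
  have 2: "neg2 B E ?x ?x (s ?x ?x)
      = act (fib E ?x x) (g ?x x ?x \<otimes>\<^bsub>A\<^esub> g \<one>\<^bsub>B\<^esub> \<one>\<^bsub>B\<^esub> ?x) (s ?x x)"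
    using neg2_act [of ?x ?x "\<one>\<^bsub>A\<^esub>"] x by simp
  show ?thesis
    unfolding symmetry_def 2
    using neg1_act [of ?x x "g ?x x ?x \<otimes>\<^bsub>A\<^esub> g \<one>\<^bsub>B\<^esub> \<one>\<^bsub>B\<^esub> ?x"] * x by simp
qed

text \<open>Source and target of the cube isomorphism both depend on the twelve chosen points only
  through the product \<open>?P\<close> of their coordinates. If a choice represents the given
  source point, freeness forces \<open>?P\<close> to be one, so the target point is
  determined.\<close>

lemma cube_iso_s:
  assumes x: "x \<in> carrier B" and y: "y \<in> carrier B" and z: "z \<in> carrier B"
  shows "cube_iso A B E x y z
      (wedge4 A (diag E (x \<otimes>\<^bsub>B\<^esub> y \<otimes>\<^bsub>B\<^esub> z)) (diag E x) (diag E y) (diag E z)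
        (s (x \<otimes>\<^bsub>B\<^esub> y \<otimes>\<^bsub>B\<^esub> z) (x \<otimes>\<^bsub>B\<^esub> y \<otimes>\<^bsub>B\<^esub> z)) (s x x) (s y y) (s z z))
    = wedge3 A (diag E (x \<otimes>\<^bsub>B\<^esub> y)) (diag E (x \<otimes>\<^bsub>B\<^esub> z)) (diag E (y \<otimes>\<^bsub>B\<^esub> z))
        (s (x \<otimes>\<^bsub>B\<^esub> y) (x \<otimes>\<^bsub>B\<^esub> y)) (s (x \<otimes>\<^bsub>B\<^esub> z) (x \<otimes>\<^bsub>B\<^esub> z)) (s (y \<otimes>\<^bsub>B\<^esub> z) (y \<otimes>\<^bsub>B\<^esub> z))"
    (is "cube_iso A B E x y z ?\<omega> = ?\<omega>'")
proof -
  let ?pt = "\<lambda>x y a. act (fib E x y) a (s x y)"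
  let ?t = "x \<otimes>\<^bsub>B\<^esub> y \<otimes>\<^bsub>B\<^esub> z"
  let ?P = "\<lambda>axx axy axz ayx ayy ayz azx azy azz dx dy dz.
    axx \<otimes>\<^bsub>A\<^esub> axy \<otimes>\<^bsub>A\<^esub> ayx \<otimes>\<^bsub>A\<^esub> ayy \<otimes>\<^bsub>A\<^esub> axz \<otimes>\<^bsub>A\<^esub> ayz \<otimes>\<^bsub>A\<^esub> azx \<otimes>\<^bsub>A\<^esub> azy \<otimes>\<^bsub>A\<^esub> azz
      \<otimes>\<^bsub>A\<^esub> dx \<otimes>\<^bsub>A\<^esub> dy \<otimes>\<^bsub>A\<^esub> dz"
  let ?\<Omega> = "\<lambda>uxx uxy uxz uyx uyy uyz uzx uzy uzz dx dy dz.
    wedge4 A (diag E ?t) (diag E x) (diag E y) (diag E z)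
      (diag_sum B E (x \<otimes>\<^bsub>B\<^esub> y) z (diag_sum B E x y uxx uxy uyx uyy)
         (add1 E x y z uxz uyz) (add2 E z x y uzx uzy) uzz) dx dy dz"
  let ?\<Omega>' = "\<lambda>uxx uxy uxz uyx uyy uyz uzx uzy uzz dx dy dz.
    wedge3 A (diag E (x \<otimes>\<^bsub>B\<^esub> y)) (diag E (x \<otimes>\<^bsub>B\<^esub> z)) (diag E (y \<otimes>\<^bsub>B\<^esub> z))
      (diag_sum B E x y uxx uxy uyx uyy)
      (diag_sum B E x z dx uxz uzx uzz)
      (diag_sum B E y z dy uyz uzy dz)"
  let ?T = "contracted A (contracted A (contracted A (diag E ?t) (diag E x)) (diag E y)) (diag E z)"
  let ?T' = "contracted A (contracted A (diag E (x \<otimes>\<^bsub>B\<^esub> y)) (diag E (x \<otimes>\<^bsub>B\<^esub> z))) (diag E (y \<otimes>\<^bsub>B\<^esub> z))"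
  have \<omega>: "?\<omega> \<in> pts ?T" and \<omega>': "?\<omega>' \<in> pts ?T'"
    using assms by (simp_all add: wedge4_def wedge3_def diag_def)
  have T: "is_torsor A ?T" and T': "is_torsor A ?T'"
    using assms by (simp_all add: diag_def)
  have \<Omega>: "?\<Omega> (?pt x x axx) (?pt x y axy) (?pt x z axz) (?pt y x ayx) (?pt y y ayy) (?pt y z ayz)
        (?pt z x azx) (?pt z y azy) (?pt z z azz) (?pt x x dx) (?pt y y dy) (?pt z z dz)
      = act ?T (?P axx axy axz ayx ayy ayz azx azy azz dx dy dz) ?\<omega>"
    if *: "axx \<in> carrier A" "axy \<in> carrier A" "axz \<in> carrier A" "ayx \<in> carrier A"
      "ayy \<in> carrier A" "ayz \<in> carrier A" "azx \<in> carrier A" "azy \<in> carrier A" "azz \<in> carrier A"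
      "dx \<in> carrier A" "dy \<in> carrier A" "dz \<in> carrier A"
    for axx axy axz ayx ayy ayz azx azy azz dx dy dz
  proof -
    \<comment> \<open>The fibre at (x + y, z) is decomposed by the first law and contributes
      \<open>p\<close>; the fibre at (z, x + y) is decomposed by the second law and contributes the
      inverse of \<open>p\<close>.\<close>
    define p where "p = g x y z"
    have p: "p \<in> carrier A"
      using assms by (simp add: p_def)
    have "axx \<otimes>\<^bsub>A\<^esub> axy \<otimes>\<^bsub>A\<^esub> ayx \<otimes>\<^bsub>A\<^esub> ayy \<otimes>\<^bsub>A\<^esub> (axz \<otimes>\<^bsub>A\<^esub> ayz \<otimes>\<^bsub>A\<^esub> p)
          \<otimes>\<^bsub>A\<^esub> (azx \<otimes>\<^bsub>A\<^esub> azy \<otimes>\<^bsub>A\<^esub> inv\<^bsub>A\<^esub> p) \<otimes>\<^bsub>A\<^esub> azz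
        = (axx \<otimes>\<^bsub>A\<^esub> axy \<otimes>\<^bsub>A\<^esub> ayx \<otimes>\<^bsub>A\<^esub> ayy \<otimes>\<^bsub>A\<^esub> axz \<otimes>\<^bsub>A\<^esub> ayz \<otimes>\<^bsub>A\<^esub> azx \<otimes>\<^bsub>A\<^esub> azy \<otimes>\<^bsub>A\<^esub> azz)
          \<otimes>\<^bsub>A\<^esub> (p \<otimes>\<^bsub>A\<^esub> inv\<^bsub>A\<^esub> p)"
      using * p by (simp only: A.m_ac A.m_closed A.inv_closed)
    also have "\<dots> = axx \<otimes>\<^bsub>A\<^esub> axy \<otimes>\<^bsub>A\<^esub> ayx \<otimes>\<^bsub>A\<^esub> ayy \<otimes>\<^bsub>A\<^esub> axz \<otimes>\<^bsub>A\<^esub> ayz \<otimes>\<^bsub>A\<^esub> azx \<otimes>\<^bsub>A\<^esub> azy \<otimes>\<^bsub>A\<^esub> azz"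
      using * p by simp
    finally have "diag_sum B E (x \<otimes>\<^bsub>B\<^esub> y) z
          (diag_sum B E x y (?pt x x axx) (?pt x y axy) (?pt y x ayx) (?pt y y ayy))
          (add1 E x y z (?pt x z axz) (?pt y z ayz)) (add2 E z x y (?pt z x azx) (?pt z y azy))
          (?pt z z azz)
        = ?pt ?t ?t (axx \<otimes>\<^bsub>A\<^esub> axy \<otimes>\<^bsub>A\<^esub> ayx \<otimes>\<^bsub>A\<^esub> ayy \<otimes>\<^bsub>A\<^esub> axz \<otimes>\<^bsub>A\<^esub> ayz \<otimes>\<^bsub>A\<^esub> azx \<otimes>\<^bsub>A\<^esub> azy \<otimes>\<^bsub>A\<^esub> azz)"
      using * assms p by (simp add: diag_sum_act add1_act add2_act p_def)
    then show ?thesis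
      using * assms by (simp add: A.wedge4_act diag_def)
  qed
  have \<Omega>': "?\<Omega>' (?pt x x axx) (?pt x y axy) (?pt x z axz) (?pt y x ayx) (?pt y y ayy) (?pt y z ayz)
        (?pt z x azx) (?pt z y azy) (?pt z z azz) (?pt x x dx) (?pt y y dy) (?pt z z dz)
      = act ?T' (?P axx axy axz ayx ayy ayz azx azy azz dx dy dz) ?\<omega>'"
    if *: "axx \<in> carrier A" "axy \<in> carrier A" "axz \<in> carrier A" "ayx \<in> carrier A"
      "ayy \<in> carrier A" "ayz \<in> carrier A" "azx \<in> carrier A" "azy \<in> carrier A" "azz \<in> carrier A"
      "dx \<in> carrier A" "dy \<in> carrier A" "dz \<in> carrier A"
    for axx axy axz ayx ayy ayz azx azy azz dx dy dz
  proof -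
    have "axx \<otimes>\<^bsub>A\<^esub> axy \<otimes>\<^bsub>A\<^esub> ayx \<otimes>\<^bsub>A\<^esub> ayy \<otimes>\<^bsub>A\<^esub> (dx \<otimes>\<^bsub>A\<^esub> axz \<otimes>\<^bsub>A\<^esub> azx \<otimes>\<^bsub>A\<^esub> azz)
          \<otimes>\<^bsub>A\<^esub> (dy \<otimes>\<^bsub>A\<^esub> ayz \<otimes>\<^bsub>A\<^esub> azy \<otimes>\<^bsub>A\<^esub> dz)
        = ?P axx axy axz ayx ayy ayz azx azy azz dx dy dz"
      using * by (simp only: A.m_ac A.m_closed)
    then show ?thesis
      using * assms by (simp add: diag_sum_act A.wedge3_act diag_def)
  qed
  show ?thesis
    unfolding cube_iso_def
  proof (rule the_equality, goal_cases)
    case 1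
    \<comment> \<open>Existence: all twelve points are taken to be values of \<open>s\<close>, that
      is, with coordinate one.\<close>
    have 1: "?\<omega> = ?\<Omega> (s x x) (s x y) (s x z) (s y x) (s y y) (s y z) (s z x) (s z y) (s z z)
        (s x x) (s y y) (s z z)"
      using \<Omega> [of "\<one>\<^bsub>A\<^esub>" "\<one>\<^bsub>A\<^esub>" "\<one>\<^bsub>A\<^esub>" "\<one>\<^bsub>A\<^esub>" "\<one>\<^bsub>A\<^esub>" "\<one>\<^bsub>A\<^esub>" "\<one>\<^bsub>A\<^esub>" "\<one>\<^bsub>A\<^esub>" "\<one>\<^bsub>A\<^esub>" "\<one>\<^bsub>A\<^esub>" "\<one>\<^bsub>A\<^esub>" "\<one>\<^bsub>A\<^esub>"]
        assms \<omega> T by simp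
    have 2: "?\<omega>' = ?\<Omega>' (s x x) (s x y) (s x z) (s y x) (s y y) (s y z) (s z x) (s z y) (s z z)
        (s x x) (s y y) (s z z)"
      using \<Omega>' [of "\<one>\<^bsub>A\<^esub>" "\<one>\<^bsub>A\<^esub>" "\<one>\<^bsub>A\<^esub>" "\<one>\<^bsub>A\<^esub>" "\<one>\<^bsub>A\<^esub>" "\<one>\<^bsub>A\<^esub>" "\<one>\<^bsub>A\<^esub>" "\<one>\<^bsub>A\<^esub>" "\<one>\<^bsub>A\<^esub>" "\<one>\<^bsub>A\<^esub>" "\<one>\<^bsub>A\<^esub>" "\<one>\<^bsub>A\<^esub>"]
        assms \<omega>' T' by simp
    show ?case
      by (rule bexI [of _ "s x x"], rule bexI [of _ "s x y"], rule bexI [of _ "s x z"],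
        rule bexI [of _ "s y x"], rule bexI [of _ "s y y"], rule bexI [of _ "s y z"],
        rule bexI [of _ "s z x"], rule bexI [of _ "s z y"], rule bexI [of _ "s z z"],
        rule bexI [of _ "s x x"], rule bexI [of _ "s y y"], rule bexI [of _ "s z z"],
        rule conjI, rule 1, rule 2) (use assms in \<open>simp_all add: diag_def\<close>)
  next
    case (2 w)
    then obtain uxx uxy uxz uyx uyy uyz uzx uzy uzz dx dy dz where
      u: "uxx \<in> pts (fib E x x)" "uxy \<in> pts (fib E x y)" "uxz \<in> pts (fib E x z)"
        "uyx \<in> pts (fib E y x)" "uyy \<in> pts (fib E y y)" "uyz \<in> pts (fib E y z)"
        "uzx \<in> pts (fib E z x)" "uzy \<in> pts (fib E z y)" "uzz \<in> pts (fib E z z)"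
        "dx \<in> pts (fib E x x)" "dy \<in> pts (fib E y y)" "dz \<in> pts (fib E z z)"
      and w: "?\<omega> = ?\<Omega> uxx uxy uxz uyx uyy uyz uzx uzy uzz dx dy dz"
        "w = ?\<Omega>' uxx uxy uxz uyx uyy uyz uzx uzy uzz dx dy dz"
      unfolding diag_def by blast
    obtain axx where axx: "axx \<in> carrier A" "uxx = ?pt x x axx"
      using fib_coordinate [OF u(1) x x] .
    obtain axy where axy: "axy \<in> carrier A" "uxy = ?pt x y axy"
      using fib_coordinate [OF u(2) x y] .
    obtain axz where axz: "axz \<in> carrier A" "uxz = ?pt x z axz"
      using fib_coordinate [OF u(3) x z] .
    obtain ayx where ayx: "ayx \<in> carrier A" "uyx = ?pt y x ayx"
      using fib_coordinate [OF u(4) y x] .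
    obtain ayy where ayy: "ayy \<in> carrier A" "uyy = ?pt y y ayy"
      using fib_coordinate [OF u(5) y y] .
    obtain ayz where ayz: "ayz \<in> carrier A" "uyz = ?pt y z ayz"
      using fib_coordinate [OF u(6) y z] .
    obtain azx where azx: "azx \<in> carrier A" "uzx = ?pt z x azx"
      using fib_coordinate [OF u(7) z x] .
    obtain azy where azy: "azy \<in> carrier A" "uzy = ?pt z y azy"
      using fib_coordinate [OF u(8) z y] .
    obtain azz where azz: "azz \<in> carrier A" "uzz = ?pt z z azz"
      using fib_coordinate [OF u(9) z z] .
    obtain ex where ex: "ex \<in> carrier A" "dx = ?pt x x ex"
      using fib_coordinate [OF u(10) x x] .
    obtain ey where ey: "ey \<in> carrier A" "dy = ?pt y y ey"
      using fib_coordinate [OF u(11) y y] .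
    obtain ez where ez: "ez \<in> carrier A" "dz = ?pt z z ez"
      using fib_coordinate [OF u(12) z z] .
    note a = axx(1) axy(1) axz(1) ayx(1) ayy(1) ayz(1) azx(1) azy(1) azz(1) ex(1) ey(1) ez(1) and eq = axx(2) axy(2) axz(2) ayx(2) ayy(2) ayz(2) azx(2) azy(2) azz(2) ex(2) ey(2) ez(2)
    let ?p = "?P axx axy axz ayx ayy ayz azx azy azz ex ey ez"
    have p: "?p \<in> carrier A"
      using a by simp
    \<comment> \<open>Uniqueness: the scalar that fixes the source point must be one, and the same
      scalar relates \<open>w\<close> to the expected target.\<close>
    have "?\<omega> = act ?T ?p ?\<omega>"
      using w(1) \<Omega> [OF a] unfolding eq by (rule trans)
    then have "?p = \<one>\<^bsub>A\<^esub>"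
      using A.torsor_act_eq_self_iff [OF T \<omega> p] by simp
    then have *: "act ?T' ?p ?\<omega>' = ?\<omega>'"
      using A.torsor_act_one [OF T' \<omega>'] by simp
    have "w = act ?T' ?p ?\<omega>'"
      using w(2) \<Omega>' [OF a] unfolding eq by (rule trans)
    then show ?case
      using * by (rule trans)
  qed
qed

theorem alternating: "alternating_biextension A B E"
proof -
  have "alternating_section A B E (\<lambda>x. s x x)"
    unfolding alternating_section_def
    using symmetry_s cube_iso_s by (auto simp: diag_def)
  then show ?thesis
    using biextension_axioms by (auto simp: alternating_biextension_def)
qed

end

section \<open>Shuffle relations in an abelian group\<close>

lemma (in comm_group) cancel_mult:
  assumes "a \<otimes> z = b \<otimes> z" "a \<in> carrier G" "b \<in> carrier G" "z \<in> carrier G"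
  shows "a = b"
  using assms by simp

text \<open>The relations \<open>c\<close> in the next two lemmas are the 3-cocycle identities at the shuffles of
  \<open>x, x', x''\<close> with \<open>y\<close>, respectively of \<open>x, x'\<close> with \<open>y, y'\<close>; their product, with the odd shuffles
  inverted, is the relation to be shown, since the factors \<open>p\<close> cancel.\<close>

lemma (in comm_group) shuffle_relation_3_1:
  assumes [simp]: "g1 \<in> carrier G" "g2 \<in> carrier G" "g3 \<in> carrier G" "g4 \<in> carrier G"
    "d1 \<in> carrier G" "d2 \<in> carrier G" "d3 \<in> carrier G" "d4 \<in> carrier G"
    "m1 \<in> carrier G" "m2 \<in> carrier G" "m3 \<in> carrier G" "m4 \<in> carrier G"
    "n1 \<in> carrier G" "n2 \<in> carrier G" "n3 \<in> carrier G" "n4 \<in> carrier G"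
    "p1 \<in> carrier G" "p2 \<in> carrier G" "p3 \<in> carrier G" "p4 \<in> carrier G"
    and g: "g1 \<otimes> d1 = m1 \<otimes> n1" "g2 \<otimes> d2 = m2 \<otimes> n2" "g3 \<otimes> d3 = m3 \<otimes> n3" "g4 \<otimes> d4 = m4 \<otimes> n4"
    and c: "p1 \<otimes> m2 \<otimes> m1 = p2 \<otimes> m4" "m3 \<otimes> p3 \<otimes> d1 = p2 \<otimes> d4"
      "d3 \<otimes> p3 \<otimes> n1 = d2 \<otimes> p4" "n3 \<otimes> n4 \<otimes> p1 = n2 \<otimes> p4"
  shows "g1 \<otimes> g2 = g3 \<otimes> g4"
\<comment> \<open>Each \<open>g\<close> is the fraction \<open>m n / d\<close>: in the application
  \<open>y\<close> stands first in \<open>m\<close>, last in \<open>n\<close> and in the middle in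
  \<open>d\<close>. Multiplying by all \<open>d\<close> and \<open>p\<close> clears the
  denominators, and the two odd relations, the second and the fourth, are used from right to
  left.\<close>
proof (rule cancel_mult [where z = "d1 \<otimes> d2 \<otimes> d3 \<otimes> d4 \<otimes> p1 \<otimes> p2 \<otimes> p3 \<otimes> p4"])
  have "g1 \<otimes> g2 \<otimes> (d1 \<otimes> d2 \<otimes> d3 \<otimes> d4 \<otimes> p1 \<otimes> p2 \<otimes> p3 \<otimes> p4)
      = (g1 \<otimes> d1) \<otimes> (g2 \<otimes> d2) \<otimes> (d3 \<otimes> d4 \<otimes> p1 \<otimes> p2 \<otimes> p3 \<otimes> p4)"
    by (simp add: m_ac)
  also have "\<dots> = (p1 \<otimes> m2 \<otimes> m1) \<otimes> (p2 \<otimes> d4) \<otimes> (d3 \<otimes> p3 \<otimes> n1) \<otimes> (n2 \<otimes> p4)"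
    unfolding g by (simp add: m_ac)
  also have "\<dots> = (p2 \<otimes> m4) \<otimes> (m3 \<otimes> p3 \<otimes> d1) \<otimes> (d2 \<otimes> p4) \<otimes> (n3 \<otimes> n4 \<otimes> p1)"
    unfolding c ..
  also have "\<dots> = (m3 \<otimes> n3) \<otimes> (m4 \<otimes> n4) \<otimes> (d1 \<otimes> d2 \<otimes> p1 \<otimes> p2 \<otimes> p3 \<otimes> p4)"
    by (simp add: m_ac)
  also have "\<dots> = g3 \<otimes> g4 \<otimes> (d1 \<otimes> d2 \<otimes> d3 \<otimes> d4 \<otimes> p1 \<otimes> p2 \<otimes> p3 \<otimes> p4)"
    unfolding g [symmetric] by (simp add: m_ac)
  finally show "g1 \<otimes> g2 \<otimes> (d1 \<otimes> d2 \<otimes> d3 \<otimes> d4 \<otimes> p1 \<otimes> p2 \<otimes> p3 \<otimes> p4)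
    = g3 \<otimes> g4 \<otimes> (d1 \<otimes> d2 \<otimes> d3 \<otimes> d4 \<otimes> p1 \<otimes> p2 \<otimes> p3 \<otimes> p4)" .
qed simp_all

lemma (in comm_group) shuffle_relation_2_2:
  assumes [simp]: "g1 \<in> carrier G" "g2 \<in> carrier G" "g3 \<in> carrier G" "g4 \<in> carrier G"
    "g5 \<in> carrier G" "g6 \<in> carrier G"
    "d1 \<in> carrier G" "d2 \<in> carrier G" "d3 \<in> carrier G" "d4 \<in> carrier G" "d5 \<in> carrier G" "d6 \<in> carrier G"
    "m1 \<in> carrier G" "m2 \<in> carrier G" "m3 \<in> carrier G" "m4 \<in> carrier G" "m5 \<in> carrier G" "m6 \<in> carrier G"
    "n1 \<in> carrier G" "n2 \<in> carrier G" "n3 \<in> carrier G" "n4 \<in> carrier G" "n5 \<in> carrier G" "n6 \<in> carrier G"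
    "p1 \<in> carrier G" "p2 \<in> carrier G" "p3 \<in> carrier G" "p4 \<in> carrier G" "p5 \<in> carrier G" "p6 \<in> carrier G"
    and g: "g1 \<otimes> d1 = m1 \<otimes> n1" "g2 \<otimes> d2 = m2 \<otimes> n2" "g3 \<otimes> d3 = m3 \<otimes> n3"
      "g4 \<otimes> d4 = m4 \<otimes> n4" "g5 \<otimes> d5 = m5 \<otimes> n5" "g6 \<otimes> d6 = m6 \<otimes> n6"
    and c: "m4 \<otimes> p1 \<otimes> n1 = m6 \<otimes> n5" "d4 \<otimes> p1 \<otimes> d1 = p3 \<otimes> p4" "n4 \<otimes> d5 \<otimes> m3 = p5 \<otimes> p4"
      "n2 \<otimes> d6 \<otimes> m1 = p3 \<otimes> p6" "d2 \<otimes> p2 \<otimes> d3 = p5 \<otimes> p6" "m2 \<otimes> p2 \<otimes> n3 = m5 \<otimes> n6"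
  shows "g1 \<otimes> g2 \<otimes> (g3 \<otimes> g4) = g5 \<otimes> g6"
proof (rule cancel_mult [where z = "d1 \<otimes> d2 \<otimes> d3 \<otimes> d4 \<otimes> d5 \<otimes> d6 \<otimes> p1 \<otimes> p2 \<otimes> p3 \<otimes> p4 \<otimes> p5 \<otimes> p6"])
  have "g1 \<otimes> g2 \<otimes> (g3 \<otimes> g4) \<otimes> (d1 \<otimes> d2 \<otimes> d3 \<otimes> d4 \<otimes> d5 \<otimes> d6 \<otimes> p1 \<otimes> p2 \<otimes> p3 \<otimes> p4 \<otimes> p5 \<otimes> p6)
      = (g1 \<otimes> d1) \<otimes> (g2 \<otimes> d2) \<otimes> (g3 \<otimes> d3) \<otimes> (g4 \<otimes> d4) \<otimes> (d5 \<otimes> d6 \<otimes> p1 \<otimes> p2 \<otimes> p3 \<otimes> p4 \<otimes> p5 \<otimes> p6)"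
    by (simp add: m_ac)
  \<comment> \<open>The left sides of the four even relations are collected here together with the
    right sides of the odd ones, the second and the fifth.\<close>
  also have "\<dots> = (m4 \<otimes> p1 \<otimes> n1) \<otimes> (n4 \<otimes> d5 \<otimes> m3) \<otimes> (n2 \<otimes> d6 \<otimes> m1) \<otimes> (m2 \<otimes> p2 \<otimes> n3)
      \<otimes> (p3 \<otimes> p4) \<otimes> (p5 \<otimes> p6)"
    unfolding g by (simp add: m_ac)
  also have "\<dots> = (m6 \<otimes> n5) \<otimes> (p5 \<otimes> p4) \<otimes> (p3 \<otimes> p6) \<otimes> (m5 \<otimes> n6) \<otimes> (d4 \<otimes> p1 \<otimes> d1) \<otimes> (d2 \<otimes> p2 \<otimes> d3)"
    unfolding c ..
  also have "\<dots> = (m5 \<otimes> n5) \<otimes> (m6 \<otimes> n6) \<otimes> (d1 \<otimes> d2 \<otimes> d3 \<otimes> d4 \<otimes> p1 \<otimes> p2 \<otimes> p3 \<otimes> p4 \<otimes> p5 \<otimes> p6)"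
    by (simp add: m_ac)
  also have "\<dots> = g5 \<otimes> g6 \<otimes> (d1 \<otimes> d2 \<otimes> d3 \<otimes> d4 \<otimes> d5 \<otimes> d6 \<otimes> p1 \<otimes> p2 \<otimes> p3 \<otimes> p4 \<otimes> p5 \<otimes> p6)"
    unfolding g [symmetric] by (simp add: m_ac)
  finally show "g1 \<otimes> g2 \<otimes> (g3 \<otimes> g4) \<otimes> (d1 \<otimes> d2 \<otimes> d3 \<otimes> d4 \<otimes> d5 \<otimes> d6 \<otimes> p1 \<otimes> p2 \<otimes> p3 \<otimes> p4 \<otimes> p5 \<otimes> p6) = g5 \<otimes> g6 \<otimes> (d1 \<otimes> d2 \<otimes> d3 \<otimes> d4 \<otimes> d5 \<otimes> d6 \<otimes> p1 \<otimes> p2 \<otimes> p3 \<otimes> p4 \<otimes> p5 \<otimes> p6)" .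
qed simp_all

section \<open>Automorphisms in a group-like monoidal groupoid\<close>

context monoidal_category
begin

lemma Hom_iff: "f \<in> Hom C X Y \<longleftrightarrow> f \<in> Arr C \<and> Dom C f = X \<and> Cod C f = Y"
  by (simp add: Hom_def)

lemma Arr_Hom: "f \<in> Arr C \<Longrightarrow> f \<in> Hom C (Dom C f) (Cod C f)"
  by (simp add: Hom_def)

declare Dom_closed [simp] Cod_closed [simp] Unit_closed [simp] TenO_closed [simp]

lemma Arr_Id [simp]:
  assumes "X \<in> Ob C"
  shows "Id C X \<in> Arr C" "Dom C (Id C X) = X" "Cod C (Id C X) = X"
  using Id_closed [OF assms] by (simp_all add: Hom_iff)

lemma Arr_Comp [simp]:
  assumes "f \<in> Arr C" "g \<in> Arr C" "Cod C f = Dom C g"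
  shows "g \<cdot> f \<in> Arr C" "Dom C (g \<cdot> f) = Dom C f" "Cod C (g \<cdot> f) = Cod C g"
  using Comp_closed [of f "Dom C f" "Dom C g" g "Cod C g"] assms by (simp_all add: Hom_iff)

lemma Arr_TenA [simp]:
  assumes "f \<in> Arr C" "g \<in> Arr C"
  shows "f \<boxtimes> g \<in> Arr C" "Dom C (f \<boxtimes> g) = Dom C f \<odot> Dom C g"
    "Cod C (f \<boxtimes> g) = Cod C f \<odot> Cod C g"
  using TenA_closed [OF assms [THEN Arr_Hom]] by (simp_all add: Hom_iff)

lemma Comp_Id_right [simp]: "\<lbrakk>f \<in> Arr C; Dom C f = X\<rbrakk> \<Longrightarrow> f \<cdot> Id C X = f"
  using Comp_Id [of f X "Cod C f"] by (simp add: Hom_iff)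

lemma Comp_Id_left [simp]: "\<lbrakk>f \<in> Arr C; Cod C f = X\<rbrakk> \<Longrightarrow> Id C X \<cdot> f = f"
  using Id_Comp [of f "Dom C f" X] by (simp add: Hom_iff)

lemma Comp_assoc' [simp]:
  "\<lbrakk>f \<in> Arr C; g \<in> Arr C; h \<in> Arr C; Cod C f = Dom C g; Cod C g = Dom C h\<rbrakk>
    \<Longrightarrow> (h \<cdot> g) \<cdot> f = h \<cdot> g \<cdot> f"
  using Comp_assoc [of f "Dom C f" "Dom C g" g "Dom C h" h "Cod C h"] by (simp add: Hom_iff)

declare TenA_Id [simp]

lemma TenA_Comp':
  "\<lbrakk>f \<in> Arr C; f' \<in> Arr C; g \<in> Arr C; g' \<in> Arr C; Cod C f = Dom C f'; Cod C g = Dom C g'\<rbrakk>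
    \<Longrightarrow> (f' \<boxtimes> g') \<cdot> (f \<boxtimes> g) = (f' \<cdot> f) \<boxtimes> (g' \<cdot> g)"
  by (rule TenA_Comp [symmetric, of _ "Dom C f" "Dom C f'" _ "Cod C f'" _ "Dom C g" "Dom C g'" _ "Cod C g'"])
    (simp_all add: Hom_iff)

lemma Arr_Assoc [simp]:
  assumes "X \<in> Ob C" "Y \<in> Ob C" "Z \<in> Ob C"
  shows "Assoc C X Y Z \<in> Arr C" "Dom C (Assoc C X Y Z) = X \<odot> (Y \<odot> Z)"
    "Cod C (Assoc C X Y Z) = (X \<odot> Y) \<odot> Z"
  using Assoc_Isom [OF assms] by (simp_all add: Hom_iff Isom_def)

lemma Arr_LUnit [simp]:
  assumes "X \<in> Ob C"
  shows "LUnit C X \<in> Arr C" "Dom C (LUnit C X) = Unit C \<odot> X" "Cod C (LUnit C X) = X"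
  using LUnit_Isom [OF assms] by (simp_all add: Hom_iff Isom_def)

lemma Arr_RUnit [simp]:
  assumes "X \<in> Ob C"
  shows "RUnit C X \<in> Arr C" "Dom C (RUnit C X) = X \<odot> Unit C" "Cod C (RUnit C X) = X"
  using RUnit_Isom [OF assms] by (simp_all add: Hom_iff Isom_def)

lemma Assoc_natural':
  "\<lbrakk>f \<in> Arr C; g \<in> Arr C; h \<in> Arr C; Cod C f = X; Cod C g = Y; Cod C h = Z\<rbrakk>
    \<Longrightarrow> Assoc C X Y Z \<cdot> (f \<boxtimes> (g \<boxtimes> h))
      = ((f \<boxtimes> g) \<boxtimes> h) \<cdot> Assoc C (Dom C f) (Dom C g) (Dom C h)"
  by (rule Assoc_natural) (simp_all add: Hom_iff)

lemma LUnit_natural':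
  "\<lbrakk>f \<in> Arr C; Cod C f = Y\<rbrakk> \<Longrightarrow> LUnit C Y \<cdot> (Id C (Unit C) \<boxtimes> f) = f \<cdot> LUnit C (Dom C f)"
  by (rule LUnit_natural) (simp add: Hom_iff)

lemma RUnit_natural':
  "\<lbrakk>f \<in> Arr C; Cod C f = Y\<rbrakk> \<Longrightarrow> RUnit C Y \<cdot> (f \<boxtimes> Id C (Unit C)) = f \<cdot> RUnit C (Dom C f)"
  by (rule RUnit_natural) (simp add: Hom_iff)

end

section \<open>Inverses and cancellation of tensor factors\<close>

context group_like_monoidal_groupoid
begin

lemma Inv_works:
  assumes f: "f \<in> Arr C"
  shows "inverse_arrows C f (Inv C f)"
proof -
  have "f \<in> Isom C (Dom C f) (Cod C f)"
    using f arrows_invertible Arr_Hom by blast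
  then obtain g where g: "inverse_arrows C f g"
    by (auto simp: Isom_def)
  have "h = g" if h: "inverse_arrows C f h" for h
  proof -
    have "h = h \<cdot> f \<cdot> g"
      using f g h by (simp add: inverse_arrows_def Hom_iff)
    also have "\<dots> = (h \<cdot> f) \<cdot> g"
      using f g h by (intro Comp_assoc' [symmetric]) (simp_all add: inverse_arrows_def Hom_iff)
    also have "h \<cdot> f = Id C (Dom C f)"
      using h by (simp add: inverse_arrows_def)
    finally show ?thesis
      using f g by (simp add: inverse_arrows_def Hom_iff)
  qed
  then show ?thesis
    unfolding Inv_def using g by (rule_tac theI)
qed

lemma Inv_simps [simp]:
  assumes "f \<in> Arr C"
  shows "Inv C f \<in> Arr C" "Dom C (Inv C f) = Cod C f" "Cod C (Inv C f) = Dom C f"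
    "Inv C f \<cdot> f = Id C (Dom C f)" "f \<cdot> Inv C f = Id C (Cod C f)"
  using Inv_works [OF assms] by (simp_all add: inverse_arrows_def Hom_iff)

text \<open>Simplification nests composites to the right, where an arrow and its inverse meet in
  front of a tail; this rule and the next cancel such pairs.\<close>

lemma Inv_Comp [simp]:
  "\<lbrakk>f \<in> Arr C; g \<in> Arr C; Cod C g = Dom C f\<rbrakk> \<Longrightarrow> Inv C f \<cdot> f \<cdot> g = g"
  using Comp_assoc' [of g f "Inv C f"] by simp

lemma Comp_Inv [simp]:
  "\<lbrakk>f \<in> Arr C; g \<in> Arr C; Cod C g = Cod C f\<rbrakk> \<Longrightarrow> f \<cdot> Inv C f \<cdot> g = g"
  using Comp_assoc' [of g "Inv C f" f] by simp

lemma Isom_eq_Hom: "Isom C X Y = Hom C X Y"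
  using arrows_invertible by (auto simp: Isom_def)

lemma Comp_cancel_left:
  assumes "h \<cdot> f = h \<cdot> g" "f \<in> Arr C" "g \<in> Arr C" "h \<in> Arr C" "Cod C f = Dom C h" "Cod C g = Dom C h"
  shows "f = g"
  using assms Inv_Comp by metis

lemma Comp_cancel_right:
  assumes "f \<cdot> h = g \<cdot> h" "f \<in> Arr C" "g \<in> Arr C" "h \<in> Arr C" "Dom C f = Cod C h" "Dom C g = Cod C h"
  shows "f = g"
proof -
  have "f = (f \<cdot> h) \<cdot> Inv C h"
    using assms(2-) by simp
  also have "\<dots> = g"
    unfolding assms(1) using assms(2-) by simp
  finally show ?thesis .
qed

lemma unit_isomorphism:
  assumes "isomorphic C X (Unit C)"
  obtains i where "i \<in> Arr C" "Dom C i = X" "Cod C i = Unit C"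
proof -
  obtain i where "i \<in> Hom C X (Unit C)"
    using assms unfolding isomorphic_def Isom_eq_Hom by blast
  then show ?thesis
    using that [of i] by (simp add: Hom_iff)
qed

text \<open>\<open>Z'\<close> is a tensor inverse of \<open>Z\<close>, and \<open>k\<close> the resulting natural isomorphism.\<close>

lemma tensor_retraction:
  assumes Z: "Z \<in> Ob C"
  obtains Z' k where "Z' \<in> Ob C"
    "\<And>W. W \<in> Ob C \<Longrightarrow> k W \<in> Arr C \<and> Dom C (k W) = (W \<odot> Z) \<odot> Z' \<and> Cod C (k W) = W"
    "\<And>w. w \<in> Arr C \<Longrightarrow> w \<cdot> k (Dom C w) = k (Cod C w) \<cdot> ((w \<boxtimes> Id C Z) \<boxtimes> Id C Z')"
proof -
  obtain Z' where Z': "Z' \<in> Ob C" "isomorphic C (Z \<odot> Z') (Unit C)"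
    using objects_invertible Z by blast
  obtain i where i: "i \<in> Arr C" "Dom C i = Z \<odot> Z'" "Cod C i = Unit C"
    using unit_isomorphism Z' by blast
  \<comment> \<open>The canonical path from \<open>(W \<odot> Z) \<odot> Z'\<close> through
    \<open>W \<odot> (Z \<odot> Z')\<close> and \<open>W \<odot> Unit C\<close> to
    \<open>W\<close>.\<close>
  define k where "k W = RUnit C W \<cdot> (Id C W \<boxtimes> i) \<cdot> Inv C (Assoc C W Z Z')" for W
  have k: "k W \<in> Arr C \<and> Dom C (k W) = (W \<odot> Z) \<odot> Z' \<and> Cod C (k W) = W" if "W \<in> Ob C" for W
    using that Z Z' i by (simp add: k_def)
  have nat: "w \<cdot> k (Dom C w) = k (Cod C w) \<cdot> ((w \<boxtimes> Id C Z) \<boxtimes> Id C Z')" if w: "w \<in> Arr C" for w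
  proof -
    have 1: "(w \<boxtimes> Id C (Z \<odot> Z')) \<cdot> Inv C (Assoc C (Dom C w) Z Z')
        = Inv C (Assoc C (Cod C w) Z Z') \<cdot> ((w \<boxtimes> Id C Z) \<boxtimes> Id C Z')"
    proof (rule Comp_cancel_right [where h = "Assoc C (Dom C w) Z Z'"])
      have "Inv C (Assoc C (Cod C w) Z Z') \<cdot> ((w \<boxtimes> Id C Z) \<boxtimes> Id C Z') \<cdot> Assoc C (Dom C w) Z Z'
          = Inv C (Assoc C (Cod C w) Z Z') \<cdot> Assoc C (Cod C w) Z Z' \<cdot> (w \<boxtimes> (Id C Z \<boxtimes> Id C Z'))"
        using w Z Z' Assoc_natural' [of w "Id C Z" "Id C Z'" "Cod C w" Z Z'] by (simp del: TenA_Id)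
      then show "((w \<boxtimes> Id C (Z \<odot> Z')) \<cdot> Inv C (Assoc C (Dom C w) Z Z')) \<cdot> Assoc C (Dom C w) Z Z'
        = (Inv C (Assoc C (Cod C w) Z Z') \<cdot> ((w \<boxtimes> Id C Z) \<boxtimes> Id C Z')) \<cdot> Assoc C (Dom C w) Z Z'"
        using w Z Z' by simp
    qed (use w Z Z' in simp_all)
    have 2: "(w \<boxtimes> Id C (Unit C)) \<cdot> (Id C (Dom C w) \<boxtimes> i) = (Id C (Cod C w) \<boxtimes> i) \<cdot> (w \<boxtimes> Id C (Z \<odot> Z'))"
      using w i Z Z' by (simp add: TenA_Comp')
    have "w \<cdot> k (Dom C w) = (w \<cdot> RUnit C (Dom C w)) \<cdot> (Id C (Dom C w) \<boxtimes> i) \<cdot> Inv C (Assoc C (Dom C w) Z Z')"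
      using w i Z Z' by (simp add: k_def)
    also have "\<dots> = RUnit C (Cod C w) \<cdot> ((w \<boxtimes> Id C (Unit C)) \<cdot> (Id C (Dom C w) \<boxtimes> i))
        \<cdot> Inv C (Assoc C (Dom C w) Z Z')"
      using w i Z Z' by (simp flip: RUnit_natural')
    also have "\<dots> = k (Cod C w) \<cdot> ((w \<boxtimes> Id C Z) \<boxtimes> Id C Z')"
      unfolding 2 k_def using w i Z Z' 1 by simp
    finally show ?thesis .
  qed
  show ?thesis
    using that Z' k nat by blast
qed

text \<open>Naturality of the retraction \<open>k\<close> recovers an arrow from its tensor product
  with \<open>Z\<close>.\<close>

lemma TenA_Id_cancel_right:
  assumes eq: "u \<boxtimes> Id C Z = v \<boxtimes> Id C Z" and Z: "Z \<in> Ob C" and u: "u \<in> Arr C" and v: "v \<in> Arr C"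
    and *: "Dom C v = Dom C u" "Cod C v = Cod C u"
  shows "u = v"
proof -
  obtain Z' k where k: "\<And>W. W \<in> Ob C \<Longrightarrow> k W \<in> Arr C \<and> Dom C (k W) = (W \<odot> Z) \<odot> Z' \<and> Cod C (k W) = W"
    and nat: "\<And>w. w \<in> Arr C \<Longrightarrow> w \<cdot> k (Dom C w) = k (Cod C w) \<cdot> ((w \<boxtimes> Id C Z) \<boxtimes> Id C Z')"
    using tensor_retraction [OF Z] by metis
  have "u \<cdot> k (Dom C u) = v \<cdot> k (Dom C u)"
    using nat [OF u] nat [OF v] by (simp add: eq *)
  then show ?thesis
    by (rule Comp_cancel_right) (use k u v * in simp_all)
qed

text \<open>Conjugating \<open>v\<close> tensored with \<open>Z'\<close> by the retraction gives the
  only possible candidate. It has the right image after tensoring with both \<open>Z\<close> and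
  \<open>Z'\<close>, and faithfulness of tensoring with \<open>Z'\<close> removes the second
  factor.\<close>

lemma TenA_Id_full:
  assumes Z: "Z \<in> Ob C" and v: "v \<in> Arr C" and X: "X \<in> Ob C" "Dom C v = X \<odot> Z" "Cod C v = X \<odot> Z"
  obtains a where "a \<in> Arr C" "Dom C a = X" "Cod C a = X" "a \<boxtimes> Id C Z = v"
proof -
  obtain Z' k where Z': "Z' \<in> Ob C"
    and k: "\<And>W. W \<in> Ob C \<Longrightarrow> k W \<in> Arr C \<and> Dom C (k W) = (W \<odot> Z) \<odot> Z' \<and> Cod C (k W) = W"
    and nat: "\<And>w. w \<in> Arr C \<Longrightarrow> w \<cdot> k (Dom C w) = k (Cod C w) \<cdot> ((w \<boxtimes> Id C Z) \<boxtimes> Id C Z')"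
    using tensor_retraction [OF Z] by metis
  define a where "a = k X \<cdot> (v \<boxtimes> Id C Z') \<cdot> Inv C (k X)"
  have a: "a \<in> Arr C" "Dom C a = X" "Cod C a = X"
    using v X Z' k [of X] by (simp_all add: a_def)
  have "k X \<cdot> ((a \<boxtimes> Id C Z) \<boxtimes> Id C Z') = a \<cdot> k X"
    using nat [OF a(1)] a by simp
  also have "\<dots> = k X \<cdot> (v \<boxtimes> Id C Z')"
    using v X Z' k [of X] by (simp add: a_def)
  finally have "(a \<boxtimes> Id C Z) \<boxtimes> Id C Z' = v \<boxtimes> Id C Z'"
    by (rule Comp_cancel_left) (use a v X Z Z' k [of X] in simp_all)
  then have "a \<boxtimes> Id C Z = v"
    by (rule TenA_Id_cancel_right) (use a v X Z Z' in simp_all)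
  then show ?thesis
    using a that by blast
qed

text \<open>Kelly's argument: by the pentagon and the triangle, both sides agree after tensoring on the
  left with the unit object, which is faithful.\<close>

lemma LUnit_tensor:
  assumes Y: "Y \<in> Ob C" and Z: "Z \<in> Ob C"
  shows "LUnit C (Y \<odot> Z) = (LUnit C Y \<boxtimes> Id C Z) \<cdot> Assoc C (Unit C) Y Z"
proof -
  let ?I = "Unit C"
  let ?u = "(LUnit C Y \<boxtimes> Id C Z) \<cdot> Assoc C ?I Y Z"
  note YZ = Y Z Unit_closed
  have "Assoc C ?I Y Z \<cdot> (Id C ?I \<boxtimes> ?u)
      = Assoc C ?I Y Z \<cdot> (Id C ?I \<boxtimes> (LUnit C Y \<boxtimes> Id C Z)) \<cdot> (Id C ?I \<boxtimes> Assoc C ?I Y Z)"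
    using YZ by (simp add: TenA_Comp')
  also have "\<dots> = (Assoc C ?I Y Z \<cdot> (Id C ?I \<boxtimes> (LUnit C Y \<boxtimes> Id C Z))) \<cdot> (Id C ?I \<boxtimes> Assoc C ?I Y Z)"
    using YZ by simp
  also have "\<dots> = ((Id C ?I \<boxtimes> LUnit C Y) \<boxtimes> Id C Z) \<cdot> Assoc C ?I (?I \<odot> Y) Z \<cdot> (Id C ?I \<boxtimes> Assoc C ?I Y Z)"
    using YZ by (simp add: Assoc_natural')
  also have "\<dots> = ((RUnit C ?I \<boxtimes> Id C Y) \<boxtimes> Id C Z) \<cdot> (Assoc C ?I ?I Y \<boxtimes> Id C Z)
      \<cdot> Assoc C ?I (?I \<odot> Y) Z \<cdot> (Id C ?I \<boxtimes> Assoc C ?I Y Z)"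
  proof -
    have "(Id C ?I \<boxtimes> LUnit C Y) \<boxtimes> Id C Z
        = ((RUnit C ?I \<boxtimes> Id C Y) \<boxtimes> Id C Z) \<cdot> (Assoc C ?I ?I Y \<boxtimes> Id C Z)"
      using YZ triangle [of ?I Y] by (simp add: TenA_Comp')
    then show ?thesis
      using YZ by simp
  qed
  also have "\<dots> = (((RUnit C ?I \<boxtimes> Id C Y) \<boxtimes> Id C Z) \<cdot> Assoc C (?I \<odot> ?I) Y Z) \<cdot> Assoc C ?I ?I (Y \<odot> Z)"
    using YZ pentagon [of ?I ?I Y Z] by simp
  also have "\<dots> = (Assoc C ?I Y Z \<cdot> (RUnit C ?I \<boxtimes> (Id C Y \<boxtimes> Id C Z))) \<cdot> Assoc C ?I ?I (Y \<odot> Z)"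
    using YZ by (simp add: Assoc_natural' del: TenA_Id)
  also have "\<dots> = Assoc C ?I Y Z \<cdot> (Id C ?I \<boxtimes> LUnit C (Y \<odot> Z))"
    using YZ triangle [of ?I "Y \<odot> Z"] by simp
  finally have "Id C ?I \<boxtimes> ?u = Id C ?I \<boxtimes> LUnit C (Y \<odot> Z)"
    by (rule Comp_cancel_left) (use YZ in simp_all)
  \<comment> \<open>Naturality of the left unit constraint is what makes tensoring with the unit
    object faithful.\<close>
  then have "?u \<cdot> LUnit C (?I \<odot> (Y \<odot> Z)) = LUnit C (Y \<odot> Z) \<cdot> LUnit C (?I \<odot> (Y \<odot> Z))"
    using YZ LUnit_natural' [of ?u "Y \<odot> Z"] LUnit_natural' [of "LUnit C (Y \<odot> Z)" "Y \<odot> Z"] by simp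
  then show ?thesis
    by (rule Comp_cancel_right [symmetric]) (use YZ in simp_all)
qed

section \<open>Automorphisms of objects as scalars\<close>

lemma carrier_pi1: "a \<in> carrier (pi1 C) \<longleftrightarrow> a \<in> Arr C \<and> Dom C a = Unit C \<and> Cod C a = Unit C"
  by (simp add: pi1_def Isom_eq_Hom Hom_iff)

lemma Arr_left_aut [simp]:
  assumes "a \<in> carrier (pi1 C)" "X \<in> Ob C"
  shows "left_aut C a X \<in> Arr C" "Dom C (left_aut C a X) = X" "Cod C (left_aut C a X) = X"
  using assms by (simp_all add: left_aut_def carrier_pi1)

lemma left_aut_LUnit:
  "\<lbrakk>a \<in> carrier (pi1 C); X \<in> Ob C\<rbrakk> \<Longrightarrow> left_aut C a X \<cdot> LUnit C X = LUnit C X \<cdot> (a \<boxtimes> Id C X)"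
  by (simp add: left_aut_def carrier_pi1)

lemma left_aut_one [simp]: "X \<in> Ob C \<Longrightarrow> left_aut C \<one>\<^bsub>pi1 C\<^esub> X = Id C X"
  by (simp add: left_aut_def pi1_def)

lemma left_aut_mult:
  assumes "a \<in> carrier (pi1 C)" "b \<in> carrier (pi1 C)" "X \<in> Ob C"
  shows "left_aut C (a \<otimes>\<^bsub>pi1 C\<^esub> b) X = left_aut C a X \<cdot> left_aut C b X"
proof -
  have "(a \<cdot> b) \<boxtimes> Id C X = (a \<boxtimes> Id C X) \<cdot> (b \<boxtimes> Id C X)"
    using assms by (simp add: TenA_Comp' carrier_pi1)
  then show ?thesis
    using assms by (simp add: left_aut_def carrier_pi1) (simp add: pi1_def)
qed

text \<open>After transport along the left unit constraint, \<open>a\<close> acts on the unit factor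
  and \<open>u\<close> on the other one, so they commute by functoriality of the tensor
  product.\<close>

lemma left_aut_natural:
  assumes a: "a \<in> carrier (pi1 C)" and u: "u \<in> Arr C"
  shows "u \<cdot> left_aut C a (Dom C u) = left_aut C a (Cod C u) \<cdot> u"
proof (rule Comp_cancel_right)
  note a' = a [unfolded carrier_pi1]
  have "(u \<cdot> left_aut C a (Dom C u)) \<cdot> LUnit C (Dom C u) = (u \<cdot> LUnit C (Dom C u)) \<cdot> (a \<boxtimes> Id C (Dom C u))"
    using a a' u by (simp add: left_aut_LUnit)
  also have "\<dots> = LUnit C (Cod C u) \<cdot> (Id C (Unit C) \<boxtimes> u) \<cdot> (a \<boxtimes> Id C (Dom C u))"
    using a' u by (simp flip: LUnit_natural')
  also have "\<dots> = (LUnit C (Cod C u) \<cdot> (a \<boxtimes> Id C (Cod C u))) \<cdot> (Id C (Unit C) \<boxtimes> u)"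
    using a' u by (simp add: TenA_Comp')
  also have "\<dots> = left_aut C a (Cod C u) \<cdot> LUnit C (Cod C u) \<cdot> (Id C (Unit C) \<boxtimes> u)"
    using a a' u by (simp flip: left_aut_LUnit)
  also have "\<dots> = (left_aut C a (Cod C u) \<cdot> u) \<cdot> LUnit C (Dom C u)"
    using a u by (simp add: LUnit_natural')
  finally show "(u \<cdot> left_aut C a (Dom C u)) \<cdot> LUnit C (Dom C u)
    = (left_aut C a (Cod C u) \<cdot> u) \<cdot> LUnit C (Dom C u)" .
qed (use a u in simp_all)

lemma left_aut_inject:
  assumes "left_aut C a X = left_aut C b X" "a \<in> carrier (pi1 C)" "b \<in> carrier (pi1 C)" "X \<in> Ob C"
  shows "a = b"
proof -
  have "LUnit C X \<cdot> (a \<boxtimes> Id C X) = LUnit C X \<cdot> (b \<boxtimes> Id C X)"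
    using assms by (simp flip: left_aut_LUnit)
  then have "a \<boxtimes> Id C X = b \<boxtimes> Id C X"
    by (rule Comp_cancel_left) (use assms in \<open>simp_all add: carrier_pi1\<close>)
  then show ?thesis
    by (rule TenA_Id_cancel_right) (use assms in \<open>simp_all add: carrier_pi1\<close>)
qed

text \<open>Together with injectivity this identifies Aut(X) with A; it rests on fullness of
  tensoring with \<open>X\<close>, applied to \<open>w\<close> conjugated by the left unit
  constraint.\<close>

lemma left_aut_surj:
  assumes "w \<in> Arr C" "Dom C w = X" "Cod C w = X" "X \<in> Ob C"
  obtains a where "a \<in> carrier (pi1 C)" "left_aut C a X = w"
proof -
  obtain a where "a \<in> Arr C" "Dom C a = Unit C" "Cod C a = Unit C"
      "a \<boxtimes> Id C X = Inv C (LUnit C X) \<cdot> w \<cdot> LUnit C X"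
    by (rule TenA_Id_full [of X "Inv C (LUnit C X) \<cdot> w \<cdot> LUnit C X" "Unit C"])
      (use assms in simp_all)
  then show ?thesis
    using assms that [of a] by (simp add: left_aut_def carrier_pi1)
qed

text \<open>By \<open>LUnit_tensor\<close> and naturality of the associator, acting on the left
  factor is acting on the whole product.\<close>

lemma left_aut_TenA_Id:
  assumes a: "a \<in> carrier (pi1 C)" and Y: "Y \<in> Ob C" and Z: "Z \<in> Ob C"
  shows "left_aut C a Y \<boxtimes> Id C Z = left_aut C a (Y \<odot> Z)"
proof (rule Comp_cancel_right)
  note a' = a [unfolded carrier_pi1]
  have "(left_aut C a Y \<boxtimes> Id C Z) \<cdot> LUnit C (Y \<odot> Z)
      = ((left_aut C a Y \<cdot> LUnit C Y) \<boxtimes> Id C Z) \<cdot> Assoc C (Unit C) Y Z"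
  proof -
    have "(left_aut C a Y \<cdot> LUnit C Y) \<boxtimes> Id C Z = (left_aut C a Y \<boxtimes> Id C Z) \<cdot> (LUnit C Y \<boxtimes> Id C Z)"
      using a Y Z by (simp add: TenA_Comp')
    then show ?thesis
      using a Y Z by (simp add: LUnit_tensor)
  qed
  also have "\<dots> = (LUnit C Y \<boxtimes> Id C Z) \<cdot> ((a \<boxtimes> Id C Y) \<boxtimes> Id C Z) \<cdot> Assoc C (Unit C) Y Z"
  proof -
    have "(LUnit C Y \<cdot> (a \<boxtimes> Id C Y)) \<boxtimes> Id C Z = (LUnit C Y \<boxtimes> Id C Z) \<cdot> ((a \<boxtimes> Id C Y) \<boxtimes> Id C Z)"
      using a' Y Z by (simp add: TenA_Comp')
    then show ?thesis
      using a a' Y Z by (simp add: left_aut_LUnit)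
  qed
  also have "\<dots> = (LUnit C Y \<boxtimes> Id C Z) \<cdot> Assoc C (Unit C) Y Z \<cdot> (a \<boxtimes> Id C (Y \<odot> Z))"
    using Assoc_natural' [of a "Id C Y" "Id C Z" "Unit C" Y Z] a' Y Z by simp
  also have "\<dots> = left_aut C a (Y \<odot> Z) \<cdot> LUnit C (Y \<odot> Z)"
    using a a' Y Z by (simp add: left_aut_LUnit) (simp add: LUnit_tensor)
  finally show "(left_aut C a Y \<boxtimes> Id C Z) \<cdot> LUnit C (Y \<odot> Z)
      = left_aut C a (Y \<odot> Z) \<cdot> LUnit C (Y \<odot> Z)" .
qed (use a Y Z in simp_all)

lemma Arr_right_aut [simp]:
  assumes "a \<in> carrier (pi1 C)" "X \<in> Ob C"
  shows "right_aut C X a \<in> Arr C" "Dom C (right_aut C X a) = X" "Cod C (right_aut C X a) = X"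
  using assms by (simp_all add: right_aut_def carrier_pi1)

text \<open>The triangle axiom lets an automorphism of a unit object inserted between
  \<open>X\<close> and \<open>Y\<close> be absorbed by either neighbour.\<close>

lemma Id_TenA_left_aut:
  assumes a: "a \<in> carrier (pi1 C)" and X: "X \<in> Ob C" and Y: "Y \<in> Ob C"
  shows "Id C X \<boxtimes> left_aut C a Y = right_aut C X a \<boxtimes> Id C Y"
proof (rule Comp_cancel_right)
  note a' = a [unfolded carrier_pi1]
  have "(Id C X \<boxtimes> left_aut C a Y) \<cdot> (Id C X \<boxtimes> LUnit C Y)
      = (Id C X \<boxtimes> LUnit C Y) \<cdot> (Id C X \<boxtimes> (a \<boxtimes> Id C Y))"
    using a a' X Y by (simp add: TenA_Comp' left_aut_LUnit)
  also have "\<dots> = (RUnit C X \<boxtimes> Id C Y) \<cdot> ((Id C X \<boxtimes> a) \<boxtimes> Id C Y) \<cdot> Assoc C X (Unit C) Y"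
    using a' X Y by (simp add: Assoc_natural' flip: triangle)
  also have "\<dots> = ((RUnit C X \<boxtimes> Id C Y) \<cdot> ((Id C X \<boxtimes> a) \<boxtimes> Id C Y)) \<cdot> Assoc C X (Unit C) Y"
    using a' X Y by simp
  also have "(RUnit C X \<boxtimes> Id C Y) \<cdot> ((Id C X \<boxtimes> a) \<boxtimes> Id C Y)
      = (right_aut C X a \<boxtimes> Id C Y) \<cdot> (RUnit C X \<boxtimes> Id C Y)"
    using a a' X Y by (simp add: TenA_Comp') (simp add: right_aut_def)
  also have "\<dots> \<cdot> Assoc C X (Unit C) Y = (right_aut C X a \<boxtimes> Id C Y) \<cdot> (Id C X \<boxtimes> LUnit C Y)"
    using a a' X Y by (simp flip: triangle)
  finally show "(Id C X \<boxtimes> left_aut C a Y) \<cdot> (Id C X \<boxtimes> LUnit C Y)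
      = (right_aut C X a \<boxtimes> Id C Y) \<cdot> (Id C X \<boxtimes> LUnit C Y)" .
qed (use a X Y in simp_all)

lemma trivial_action_right_aut:
  assumes "trivial_action C" and a: "a \<in> carrier (pi1 C)" and X: "X \<in> Ob C"
  shows "right_aut C X a = left_aut C a X"
proof -
  obtain b where b: "b \<in> carrier (pi1 C)" "left_aut C b X = right_aut C X a"
    using left_aut_surj [of "right_aut C X a" X] a X by auto
  have "pi1_action C X a = b"
    unfolding pi1_action_def
  proof (rule the_equality)
    fix b' assume "b' \<in> carrier (pi1 C) \<and> left_aut C b' X = right_aut C X a"
    then show "b' = b"
      using left_aut_inject [of b' X b] b X by argo
  qed (use b in simp)
  then show ?thesis
    using b assms by (simp add: trivial_action_def)
qed

end

section \<open>The commutator biextension in coordinates\<close>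

locale central_choice = group_like_monoidal_groupoid C + A: comm_group "pi1 C" + B: comm_group "pi0 C"
  for C :: "('o, 'm, 'z) monoidal_data_scheme" (structure)
    and R :: "'o set \<Rightarrow> 'o" and c :: "'o set \<Rightarrow> 'o set \<Rightarrow> 'm" +
  assumes trivial_action: "trivial_action C"
    and choice: "is_choice C R c"
begin

abbreviation plus (infixl \<open>\<oplus>\<close> 65) where "x \<oplus> y \<equiv> x \<otimes>\<^bsub>pi0 C\<^esub> y"
abbreviation times (infixl \<open>\<otimes>\<close> 70) where "a \<otimes> b \<equiv> a \<otimes>\<^bsub>pi1 C\<^esub> b"
abbreviation inverse_pi1 (\<open>\<i> _\<close> [81] 80) where "\<i> a \<equiv> inv\<^bsub>pi1 C\<^esub> a"

section \<open>Scalar multiplication of arrows\<close>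

lemma R_closed [simp]: "x \<in> carrier (pi0 C) \<Longrightarrow> R x \<in> Ob C"
  using choice by (force simp: is_choice_def pi0_def iso_classes_def quotient_def)

lemma Arr_c [simp]:
  assumes "x \<in> carrier (pi0 C)" "y \<in> carrier (pi0 C)"
  shows "c x y \<in> Arr C" "Dom C (c x y) = R x \<odot> R y" "Cod C (c x y) = R (x \<oplus> y)"
  using assms choice unfolding is_choice_def Hom_iff by blast+

text \<open>The action of A on all sets of arrows at once, which on the fibres of the commutator is
  their torsor action. The scalar is applied at the codomain; by \<open>left_aut_natural\<close> the
  domain would give the same arrow.\<close>

definition scale :: "'m \<Rightarrow> 'm \<Rightarrow> 'm" where
  "scale a u = left_aut C a (Cod C u) \<cdot> u"

lemma Arr_scale [simp]:
  assumes "a \<in> carrier (pi1 C)" "u \<in> Arr C"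
  shows "scale a u \<in> Arr C" "Dom C (scale a u) = Dom C u" "Cod C (scale a u) = Cod C u"
  using assms by (simp_all add: scale_def)

lemma scale_one [simp]: "u \<in> Arr C \<Longrightarrow> scale \<one>\<^bsub>pi1 C\<^esub> u = u"
  by (simp add: scale_def)

lemma scale_scale [simp]:
  "\<lbrakk>a \<in> carrier (pi1 C); b \<in> carrier (pi1 C); u \<in> Arr C\<rbrakk> \<Longrightarrow> scale a (scale b u) = scale (a \<otimes> b) u"
  by (simp add: scale_def left_aut_mult)

lemma scale_Comp [simp]:
  "\<lbrakk>a \<in> carrier (pi1 C); u \<in> Arr C; v \<in> Arr C; Cod C v = Dom C u\<rbrakk>
    \<Longrightarrow> scale a u \<cdot> v = scale a (u \<cdot> v)"
  by (simp add: scale_def)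

lemma Comp_scale [simp]:
  assumes "a \<in> carrier (pi1 C)" "u \<in> Arr C" "v \<in> Arr C" "Cod C v = Dom C u"
  shows "u \<cdot> scale a v = scale a (u \<cdot> v)"
proof -
  have "u \<cdot> scale a v = (u \<cdot> left_aut C a (Dom C u)) \<cdot> v"
    using assms by (simp add: scale_def)
  then show ?thesis
    using assms by (simp add: left_aut_natural) (simp add: scale_def)
qed

lemma scale_TenA [simp]:
  assumes "a \<in> carrier (pi1 C)" "u \<in> Arr C" "v \<in> Arr C"
  shows "scale a u \<boxtimes> v = scale a (u \<boxtimes> v)"
proof -
  have "scale a u \<boxtimes> v = (left_aut C a (Cod C u) \<boxtimes> Id C (Cod C v)) \<cdot> (u \<boxtimes> v)"
    using assms by (simp add: scale_def TenA_Comp')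
  then show ?thesis
    using assms by (simp add: left_aut_TenA_Id scale_def)
qed

text \<open>A scalar leaving the right tensor factor becomes a right automorphism of the left
  factor, thus is twisted by the class of that factor. Here the triviality of the action
  enters.\<close>

lemma TenA_scale [simp]:
  assumes "a \<in> carrier (pi1 C)" "u \<in> Arr C" "v \<in> Arr C"
  shows "u \<boxtimes> scale a v = scale a (u \<boxtimes> v)"
proof -
  have "u \<boxtimes> scale a v = (Id C (Cod C u) \<boxtimes> left_aut C a (Cod C v)) \<cdot> (u \<boxtimes> v)"
    using assms by (simp add: scale_def TenA_Comp')
  then show ?thesis
    using assms trivial_action
    by (simp add: Id_TenA_left_aut trivial_action_right_aut left_aut_TenA_Id scale_def)
qed

lemma scale_inject [simp]:
  assumes "a \<in> carrier (pi1 C)" "b \<in> carrier (pi1 C)" "u \<in> Arr C"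
  shows "scale a u = scale b u \<longleftrightarrow> a = b"
proof
  assume "scale a u = scale b u"
  then have "left_aut C a (Cod C u) = left_aut C b (Cod C u)"
    unfolding scale_def by (rule Comp_cancel_right) (use assms in simp_all)
  then show "a = b"
    by (rule left_aut_inject) (use assms in simp_all)
qed simp

lemma scale_surj:
  assumes "u \<in> Arr C" "v \<in> Arr C" "Dom C v = Dom C u" "Cod C v = Cod C u"
  obtains a where "a \<in> carrier (pi1 C)" "v = scale a u"
proof -
  obtain a where "a \<in> carrier (pi1 C)" "left_aut C a (Cod C u) = v \<cdot> Inv C u"
    by (rule left_aut_surj [of "v \<cdot> Inv C u" "Cod C u"]) (use assms in simp_all)
  then show ?thesis
    using that [of a] assms by (simp add: scale_def)
qed

lemma scale_torsor:
  "is_torsor (pi1 C) (fib (commutator C R c) x y)"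
  if "x \<in> carrier (pi0 C)" "y \<in> carrier (pi0 C)"
proof -
  have act: "act (fib (commutator C R c) x y) a u = scale a u"
    if "u \<in> Hom C (R y \<odot> R x) (R x \<odot> R y)" for a u
    using that by (simp add: commutator_def scale_def Hom_iff)
  have pts: "pts (fib (commutator C R c) x y) = Hom C (R y \<odot> R x) (R x \<odot> R y)"
    by (simp add: commutator_def Isom_eq_Hom)
  \<comment> \<open>A composable pair because B is commutative: \<open>c x y\<close> and
    \<open>c y x\<close> end in the same chosen object.\<close>
  have "Inv C (c x y) \<cdot> c y x \<in> Hom C (R y \<odot> R x) (R x \<odot> R y)"
    using that by (simp add: Hom_iff B.m_comm)
  then have ne: "Hom C (R y \<odot> R x) (R x \<odot> R y) \<noteq> {}"
    by blast
  have ex: "\<exists>!a. a \<in> carrier (pi1 C) \<and> act (fib (commutator C R c) x y) a u = v"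
    if u: "u \<in> Hom C (R y \<odot> R x) (R x \<odot> R y)" and v: "v \<in> Hom C (R y \<odot> R x) (R x \<odot> R y)" for u v
  proof -
    obtain a where a: "a \<in> carrier (pi1 C)" "v = scale a u"
      using scale_surj [of u v] u v by (auto simp: Hom_iff)
    show ?thesis
      using a u unfolding act [OF u] by (intro ex1I [of _ a]) (auto simp: Hom_iff)
  qed
  have closed: "scale a u \<in> Hom C (R y \<odot> R x) (R x \<odot> R y)"
    if "a \<in> carrier (pi1 C)" "u \<in> Hom C (R y \<odot> R x) (R x \<odot> R y)" for a u
    using that by (simp add: Hom_iff)
  show ?thesis
    unfolding is_torsor_def pts
    by (intro conjI ballI ne ex) (simp_all add: act closed, simp_all add: Hom_iff)
qed

section \<open>Nested products and the 3-cocycle\<close>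

definition left_nest :: "'o set \<Rightarrow> 'o set \<Rightarrow> 'o set \<Rightarrow> 'm" where
  "left_nest x y z = c (x \<oplus> y) z \<cdot> (c x y \<boxtimes> Id C (R z))"

definition right_nest :: "'o set \<Rightarrow> 'o set \<Rightarrow> 'o set \<Rightarrow> 'm" where
  "right_nest x y z = c x (y \<oplus> z) \<cdot> (Id C (R x) \<boxtimes> c y z)"

lemma Arr_left_nest [simp]:
  assumes "x \<in> carrier (pi0 C)" "y \<in> carrier (pi0 C)" "z \<in> carrier (pi0 C)"
  shows "left_nest x y z \<in> Arr C" "Dom C (left_nest x y z) = (R x \<odot> R y) \<odot> R z"
    "Cod C (left_nest x y z) = R (x \<oplus> y \<oplus> z)"
  using assms by (simp_all add: left_nest_def)

lemma Arr_right_nest [simp]: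
  assumes "x \<in> carrier (pi0 C)" "y \<in> carrier (pi0 C)" "z \<in> carrier (pi0 C)"
  shows "right_nest x y z \<in> Arr C" "Dom C (right_nest x y z) = R x \<odot> (R y \<odot> R z)"
    "Cod C (right_nest x y z) = R (x \<oplus> y \<oplus> z)"
  using assms by (simp_all add: right_nest_def B.m_assoc)

abbreviation f where "f \<equiv> cocycle C R c"

text \<open>This replaces the definite description by a rewrite rule: an associator below a nested
  product changes the bracketing at the cost of one scalar.\<close>

lemma cocycle_works:
  assumes "x \<in> carrier (pi0 C)" "y \<in> carrier (pi0 C)" "z \<in> carrier (pi0 C)"
  shows cocycle_closed [simp]: "f x y z \<in> carrier (pi1 C)"
    and left_nest_Assoc: "left_nest x y z \<cdot> Assoc C (R x) (R y) (R z) = scale (f x y z) (right_nest x y z)"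
proof -
  obtain a where a: "a \<in> carrier (pi1 C)"
    "left_nest x y z \<cdot> Assoc C (R x) (R y) (R z) = scale a (right_nest x y z)"
    by (rule scale_surj [of "right_nest x y z" "left_nest x y z \<cdot> Assoc C (R x) (R y) (R z)"])
      (use assms in simp_all)
  have "f x y z = a"
    unfolding cocycle_def
  proof (rule the_equality)
    show "a \<in> carrier (pi1 C) \<and>
        c (x \<oplus> y) z \<cdot> (c x y \<boxtimes> Id C (R z)) \<cdot> Assoc C (R x) (R y) (R z)
        = left_aut C a (R (x \<oplus> y \<oplus> z)) \<cdot> c x (y \<oplus> z) \<cdot> (Id C (R x) \<boxtimes> c y z)"
      using a assms by (simp add: left_nest_def scale_def) (simp add: right_nest_def)
  next
    fix b assume b: "b \<in> carrier (pi1 C) \<and>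
        c (x \<oplus> y) z \<cdot> (c x y \<boxtimes> Id C (R z)) \<cdot> Assoc C (R x) (R y) (R z)
        = left_aut C b (R (x \<oplus> y \<oplus> z)) \<cdot> c x (y \<oplus> z) \<cdot> (Id C (R x) \<boxtimes> c y z)"
    then have "scale a (right_nest x y z) = scale b (right_nest x y z)"
      using a assms by (simp add: left_nest_def scale_def) (simp add: right_nest_def)
    then show "b = a"
      using a b assms by simp
  qed
  then show "f x y z \<in> carrier (pi1 C)"
    "left_nest x y z \<cdot> Assoc C (R x) (R y) (R z) = scale (f x y z) (right_nest x y z)"
    using a by simp_all
qed

text \<open>Both sides of the pentagon are composed with the arrow
  \<open>((R x \<odot> R y) \<odot> R z) \<odot> R w \<rightarrow> R (x + y + z + w)\<close>.\<close>

lemma cocycle_identity: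
  assumes x: "x \<in> carrier (pi0 C)" and y: "y \<in> carrier (pi0 C)" and z: "z \<in> carrier (pi0 C)"
    and w: "w \<in> carrier (pi0 C)"
  shows "f y z w \<otimes> f x (y \<oplus> z) w \<otimes> f x y z = f (x \<oplus> y) z w \<otimes> f x y (z \<oplus> w)"
proof -
  note [simp] = x y z w
  let ?X = "R x" and ?Y = "R y" and ?Z = "R z" and ?W = "R w"
  let ?k = "c (x \<oplus> y \<oplus> z) w \<cdot> (left_nest x y z \<boxtimes> Id C ?W)"
  let ?r = "c x (y \<oplus> z \<oplus> w) \<cdot> (Id C ?X \<boxtimes> right_nest y z w)"
  have k: "?k \<in> Arr C" "Dom C ?k = ((?X \<odot> ?Y) \<odot> ?Z) \<odot> ?W"
    by simp_all
  have r: "?r \<in> Arr C"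
    by simp
  \<comment> \<open>Long side of the pentagon: facts \<open>1\<close>, \<open>2\<close> and
    \<open>3\<close> push the nested product through one associator each, releasing one value of
    \<open>f\<close> each time.\<close>
  have "?k \<cdot> (Assoc C ?X ?Y ?Z \<boxtimes> Id C ?W)
      = c (x \<oplus> y \<oplus> z) w \<cdot> ((left_nest x y z \<cdot> Assoc C ?X ?Y ?Z) \<boxtimes> Id C ?W)"
    by (simp add: TenA_Comp')
  also have "\<dots> = scale (f x y z) (c (x \<oplus> y \<oplus> z) w \<cdot> (right_nest x y z \<boxtimes> Id C ?W))"
    by (simp add: left_nest_Assoc)
  also have "c (x \<oplus> y \<oplus> z) w \<cdot> (right_nest x y z \<boxtimes> Id C ?W)
      = left_nest x (y \<oplus> z) w \<cdot> ((Id C ?X \<boxtimes> c y z) \<boxtimes> Id C ?W)"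
    by (simp add: left_nest_def right_nest_def TenA_Comp' B.m_assoc)
  finally have 1: "?k \<cdot> (Assoc C ?X ?Y ?Z \<boxtimes> Id C ?W)
      = scale (f x y z) (left_nest x (y \<oplus> z) w \<cdot> ((Id C ?X \<boxtimes> c y z) \<boxtimes> Id C ?W))" .
  have "(left_nest x (y \<oplus> z) w \<cdot> ((Id C ?X \<boxtimes> c y z) \<boxtimes> Id C ?W)) \<cdot> Assoc C ?X (?Y \<odot> ?Z) ?W
      = (left_nest x (y \<oplus> z) w \<cdot> Assoc C ?X (R (y \<oplus> z)) ?W) \<cdot> (Id C ?X \<boxtimes> (c y z \<boxtimes> Id C ?W))"
    by (simp add: Assoc_natural')
  also have "\<dots> = scale (f x (y \<oplus> z) w) (right_nest x (y \<oplus> z) w \<cdot> (Id C ?X \<boxtimes> (c y z \<boxtimes> Id C ?W)))"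
    by (subst left_nest_Assoc) simp_all
  also have "right_nest x (y \<oplus> z) w \<cdot> (Id C ?X \<boxtimes> (c y z \<boxtimes> Id C ?W))
      = c x (y \<oplus> z \<oplus> w) \<cdot> (Id C ?X \<boxtimes> left_nest y z w)"
    by (simp add: left_nest_def right_nest_def TenA_Comp')
  finally have 2: "(left_nest x (y \<oplus> z) w \<cdot> ((Id C ?X \<boxtimes> c y z) \<boxtimes> Id C ?W)) \<cdot> Assoc C ?X (?Y \<odot> ?Z) ?W
      = scale (f x (y \<oplus> z) w) (c x (y \<oplus> z \<oplus> w) \<cdot> (Id C ?X \<boxtimes> left_nest y z w))" .
  have "(c x (y \<oplus> z \<oplus> w) \<cdot> (Id C ?X \<boxtimes> left_nest y z w)) \<cdot> (Id C ?X \<boxtimes> Assoc C ?Y ?Z ?W)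
      = c x (y \<oplus> z \<oplus> w) \<cdot> (Id C ?X \<boxtimes> (left_nest y z w \<cdot> Assoc C ?Y ?Z ?W))"
    by (simp add: TenA_Comp')
  also have "\<dots> = scale (f y z w) ?r"
    by (simp add: left_nest_Assoc)
  finally have 3: "(c x (y \<oplus> z \<oplus> w) \<cdot> (Id C ?X \<boxtimes> left_nest y z w)) \<cdot> (Id C ?X \<boxtimes> Assoc C ?Y ?Z ?W)
      = scale (f y z w) ?r" .
  have "?k \<cdot> (Assoc C ?X ?Y ?Z \<boxtimes> Id C ?W) \<cdot> Assoc C ?X (?Y \<odot> ?Z) ?W \<cdot> (Id C ?X \<boxtimes> Assoc C ?Y ?Z ?W)
      = ((?k \<cdot> (Assoc C ?X ?Y ?Z \<boxtimes> Id C ?W)) \<cdot> Assoc C ?X (?Y \<odot> ?Z) ?W) \<cdot> (Id C ?X \<boxtimes> Assoc C ?Y ?Z ?W)"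
    by simp
  also have "\<dots> = scale (f x y z) (((left_nest x (y \<oplus> z) w \<cdot> ((Id C ?X \<boxtimes> c y z) \<boxtimes> Id C ?W))
      \<cdot> Assoc C ?X (?Y \<odot> ?Z) ?W) \<cdot> (Id C ?X \<boxtimes> Assoc C ?Y ?Z ?W))"
    unfolding 1 by simp
  also have "\<dots> = scale (f x y z) (scale (f x (y \<oplus> z) w)
      ((c x (y \<oplus> z \<oplus> w) \<cdot> (Id C ?X \<boxtimes> left_nest y z w)) \<cdot> (Id C ?X \<boxtimes> Assoc C ?Y ?Z ?W)))"
    unfolding 2 by simp
  also have "\<dots> = scale (f x y z \<otimes> f x (y \<oplus> z) w \<otimes> f y z w) ?r"
    unfolding 3 by (simp add: A.m_assoc)
  finally have lhs: "?k \<cdot> (Assoc C ?X ?Y ?Z \<boxtimes> Id C ?W) \<cdot> Assoc C ?X (?Y \<odot> ?Z) ?W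
      \<cdot> (Id C ?X \<boxtimes> Assoc C ?Y ?Z ?W) = scale (f x y z \<otimes> f x (y \<oplus> z) w \<otimes> f y z w) ?r" .
  \<comment> \<open>Short side of the pentagon: two associators, hence the two values of
    \<open>f\<close> in facts \<open>4\<close> and \<open>5\<close>, with the same final arrow
    \<open>?r\<close>.\<close>
  have "?k \<cdot> Assoc C (?X \<odot> ?Y) ?Z ?W
      = left_nest (x \<oplus> y) z w \<cdot> ((c x y \<boxtimes> Id C ?Z) \<boxtimes> Id C ?W) \<cdot> Assoc C (?X \<odot> ?Y) ?Z ?W"
  proof -
    have "left_nest x y z \<boxtimes> Id C ?W
        = (c (x \<oplus> y) z \<boxtimes> Id C ?W) \<cdot> ((c x y \<boxtimes> Id C ?Z) \<boxtimes> Id C ?W)"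
      by (simp add: left_nest_def TenA_Comp')
    then show ?thesis
      by (simp add: left_nest_def [of "x \<oplus> y"])
  qed
  also have "\<dots> = (left_nest (x \<oplus> y) z w \<cdot> Assoc C (R (x \<oplus> y)) ?Z ?W) \<cdot> (c x y \<boxtimes> (Id C ?Z \<boxtimes> Id C ?W))"
    by (simp add: Assoc_natural' del: TenA_Id)
  also have "\<dots> = scale (f (x \<oplus> y) z w) (right_nest (x \<oplus> y) z w \<cdot> (c x y \<boxtimes> Id C (?Z \<odot> ?W)))"
    by (subst left_nest_Assoc) simp_all
  also have "right_nest (x \<oplus> y) z w \<cdot> (c x y \<boxtimes> Id C (?Z \<odot> ?W))
      = left_nest x y (z \<oplus> w) \<cdot> (Id C (?X \<odot> ?Y) \<boxtimes> c z w)"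
    by (simp add: right_nest_def left_nest_def TenA_Comp')
  finally have 4: "?k \<cdot> Assoc C (?X \<odot> ?Y) ?Z ?W
      = scale (f (x \<oplus> y) z w) (left_nest x y (z \<oplus> w) \<cdot> (Id C (?X \<odot> ?Y) \<boxtimes> c z w))" .
  have "(left_nest x y (z \<oplus> w) \<cdot> (Id C (?X \<odot> ?Y) \<boxtimes> c z w)) \<cdot> Assoc C ?X ?Y (?Z \<odot> ?W)
      = (left_nest x y (z \<oplus> w) \<cdot> Assoc C ?X ?Y (R (z \<oplus> w))) \<cdot> (Id C ?X \<boxtimes> (Id C ?Y \<boxtimes> c z w))"
    by (simp add: Assoc_natural')
  also have "\<dots> = scale (f x y (z \<oplus> w)) (right_nest x y (z \<oplus> w) \<cdot> (Id C ?X \<boxtimes> (Id C ?Y \<boxtimes> c z w)))"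
    by (subst left_nest_Assoc) simp_all
  also have "right_nest x y (z \<oplus> w) \<cdot> (Id C ?X \<boxtimes> (Id C ?Y \<boxtimes> c z w)) = ?r"
    by (simp add: right_nest_def TenA_Comp' B.m_assoc)
  finally have 5: "(left_nest x y (z \<oplus> w) \<cdot> (Id C (?X \<odot> ?Y) \<boxtimes> c z w)) \<cdot> Assoc C ?X ?Y (?Z \<odot> ?W)
      = scale (f x y (z \<oplus> w)) ?r" .
  have "?k \<cdot> Assoc C (?X \<odot> ?Y) ?Z ?W \<cdot> Assoc C ?X ?Y (?Z \<odot> ?W)
      = (?k \<cdot> Assoc C (?X \<odot> ?Y) ?Z ?W) \<cdot> Assoc C ?X ?Y (?Z \<odot> ?W)"
    by simp
  also have "\<dots> = scale (f (x \<oplus> y) z w)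
      ((left_nest x y (z \<oplus> w) \<cdot> (Id C (?X \<odot> ?Y) \<boxtimes> c z w)) \<cdot> Assoc C ?X ?Y (?Z \<odot> ?W))"
    unfolding 4 by simp
  also have "\<dots> = scale (f (x \<oplus> y) z w \<otimes> f x y (z \<oplus> w)) ?r"
    unfolding 5 by simp
  finally have "scale (f x y z \<otimes> f x (y \<oplus> z) w \<otimes> f y z w) ?r
      = scale (f (x \<oplus> y) z w \<otimes> f x y (z \<oplus> w)) ?r"
    unfolding lhs [symmetric] pentagon [of ?X ?Y ?Z ?W, simplified] by simp
  then have "f x y z \<otimes> f x (y \<oplus> z) w \<otimes> f y z w = f (x \<oplus> y) z w \<otimes> f x y (z \<oplus> w)"
    using r by (subst (asm) scale_inject) simp_all
  then show ?thesis
    by (simp add: A.m_ac)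
qed

lemma right_nest_Inv_Assoc:
  assumes "x \<in> carrier (pi0 C)" "y \<in> carrier (pi0 C)" "z \<in> carrier (pi0 C)"
  shows "right_nest x y z \<cdot> Inv C (Assoc C (R x) (R y) (R z)) = scale (\<i> f x y z) (left_nest x y z)"
proof (rule Comp_cancel_right [where h = "Assoc C (R x) (R y) (R z)"])
  show "(right_nest x y z \<cdot> Inv C (Assoc C (R x) (R y) (R z))) \<cdot> Assoc C (R x) (R y) (R z)
      = scale (\<i> f x y z) (left_nest x y z) \<cdot> Assoc C (R x) (R y) (R z)"
    using assms by (simp add: left_nest_Assoc)
qed (use assms in simp_all)

section \<open>The partial laws in coordinates\<close>

definition base :: "'o set \<Rightarrow> 'o set \<Rightarrow> 'm" where
  "base x y = Inv C (c x y) \<cdot> c y x"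

lemma Arr_base [simp]:
  assumes "x \<in> carrier (pi0 C)" "y \<in> carrier (pi0 C)"
  shows "base x y \<in> Arr C" "Dom C (base x y) = R y \<odot> R x" "Cod C (base x y) = R x \<odot> R y"
  using assms by (simp_all add: base_def B.m_comm)

lemma c_base: "\<lbrakk>x \<in> carrier (pi0 C); y \<in> carrier (pi0 C)\<rbrakk> \<Longrightarrow> c x y \<cdot> base x y = c y x"
  by (simp add: base_def B.m_comm)

text \<open>\<open>base\<close> is chosen so that exchanging two neighbours in a nested product
  costs no scalar; hence all of \<open>factor\<close> comes from associators.\<close>

lemma left_nest_base:
  assumes "x \<in> carrier (pi0 C)" "y \<in> carrier (pi0 C)" "z \<in> carrier (pi0 C)"
  shows "left_nest x y z \<cdot> (base x y \<boxtimes> Id C (R z)) = left_nest y x z"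
  using assms B.m_comm [of x y] by (simp add: left_nest_def TenA_Comp' c_base)

lemma right_nest_base:
  assumes "x \<in> carrier (pi0 C)" "y \<in> carrier (pi0 C)" "z \<in> carrier (pi0 C)"
  shows "right_nest x y z \<cdot> (Id C (R x) \<boxtimes> base y z) = right_nest x z y"
  using assms B.m_comm [of y z] by (simp add: right_nest_def TenA_Comp' c_base)

text \<open>Applies a rule for two adjacent arrows when the second one heads a right-nested
  composite; the laws are evaluated by consuming their arrows one by one in this way.\<close>

lemma Comp_reassoc:
  "\<lbrakk>k \<cdot> u = k'; k \<in> Arr C; u \<in> Arr C; t \<in> Arr C; Cod C u = Dom C k; Cod C t = Dom C u\<rbrakk>
    \<Longrightarrow> k \<cdot> u \<cdot> t = k' \<cdot> t"
  using Comp_assoc' [of t u k] by simp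

definition factor :: "'o set \<Rightarrow> 'o set \<Rightarrow> 'o set \<Rightarrow> 'm" where
  "factor x x' y = f y x x' \<otimes> f x x' y \<otimes> \<i> f x y x'"

lemma factor_closed [simp]:
  "\<lbrakk>x \<in> carrier (pi0 C); x' \<in> carrier (pi0 C); y \<in> carrier (pi0 C)\<rbrakk>
    \<Longrightarrow> factor x x' y \<in> carrier (pi1 C)"
  by (simp add: factor_def)

lemma right_nest_Inv_c:
  assumes "x \<in> carrier (pi0 C)" "y \<in> carrier (pi0 C)" "z \<in> carrier (pi0 C)"
  shows "right_nest x y z \<cdot> (Id C (R x) \<boxtimes> Inv C (c y z)) = c x (y \<oplus> z)"
  using assms by (simp add: right_nest_def TenA_Comp')

lemma left_nest_Inv_c:
  assumes "x \<in> carrier (pi0 C)" "y \<in> carrier (pi0 C)" "z \<in> carrier (pi0 C)"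
  shows "left_nest x y z \<cdot> (Inv C (c x y) \<boxtimes> Id C (R z)) = c (x \<oplus> y) z"
  using assms by (simp add: left_nest_def TenA_Comp')

lemma base_unique:
  assumes "x \<in> carrier (pi0 C)" "y \<in> carrier (pi0 C)" "a \<in> carrier (pi1 C)" "u \<in> Arr C"
    "Cod C u = R x \<odot> R y" "c x y \<cdot> u = scale a (c y x)"
  shows "u = scale a (base x y)"
proof (rule Comp_cancel_left [of "c x y"])
  show "c x y \<cdot> u = c x y \<cdot> scale a (base x y)"
    using assms by (simp add: c_base)
qed (use assms in simp_all)

text \<open>Composition with \<open>c (x \<oplus> x') y\<close> completes the first arrow of the law
  to a nested product. Passing this through the rest yields f(x,x',y), then the inverse of
  f(x,y,x'), then f(y,x,x'), one for each associator; \<open>base_unique\<close> converts the result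
  into a coordinate.\<close>

lemma add1_base:
  assumes x: "x \<in> carrier (pi0 C)" and x': "x' \<in> carrier (pi0 C)" and y: "y \<in> carrier (pi0 C)"
    and a: "a \<in> carrier (pi1 C)" and b: "b \<in> carrier (pi1 C)"
  shows "add1 (commutator C R c) x x' y (scale a (base x y)) (scale b (base x' y))
    = scale (a \<otimes> b \<otimes> factor x x' y) (base (x \<oplus> x') y)"
proof (rule base_unique)
  note [simp] = x x' y a b
  let ?t5 = "Id C (R y) \<boxtimes> Inv C (c x x')"
  let ?t4 = "Assoc C (R y) (R x) (R x') \<cdot> ?t5"
  let ?t3 = "(base x y \<boxtimes> Id C (R x')) \<cdot> ?t4"
  let ?t2 = "Inv C (Assoc C (R x) (R y) (R x')) \<cdot> ?t3"
  let ?t1 = "(Id C (R x) \<boxtimes> base x' y) \<cdot> ?t2"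
  let ?t0 = "Assoc C (R x) (R x') (R y) \<cdot> ?t1"
  have 1: "left_nest x x' y \<cdot> ?t0 = scale (f x x' y) (right_nest x x' y \<cdot> ?t1)"
    using Comp_reassoc [OF left_nest_Assoc, of x x' y ?t1] by simp
  have 2: "right_nest x x' y \<cdot> ?t1 = right_nest x y x' \<cdot> ?t2"
    by (rule Comp_reassoc [OF right_nest_base]) simp_all
  have 3: "right_nest x y x' \<cdot> ?t2 = scale (\<i> f x y x') (left_nest x y x' \<cdot> ?t3)"
    using Comp_reassoc [OF right_nest_Inv_Assoc, of x y x' ?t3] by simp
  have 4: "left_nest x y x' \<cdot> ?t3 = left_nest y x x' \<cdot> ?t4"
    by (rule Comp_reassoc [OF left_nest_base]) simp_all
  have 5: "left_nest y x x' \<cdot> ?t4 = scale (f y x x') (right_nest y x x' \<cdot> ?t5)"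
    using Comp_reassoc [OF left_nest_Assoc, of y x x' ?t5] by simp
  have 6: "right_nest y x x' \<cdot> ?t5 = c y (x \<oplus> x')"
    by (rule right_nest_Inv_c) simp_all
  have "add1 (commutator C R c) x x' y (scale a (base x y)) (scale b (base x' y))
      = scale (a \<otimes> b) ((c x x' \<boxtimes> Id C (R y)) \<cdot> ?t0)"
    by (simp add: commutator_def A.m_comm)
  then have "c (x \<oplus> x') y \<cdot> add1 (commutator C R c) x x' y (scale a (base x y)) (scale b (base x' y))
      = scale (a \<otimes> b) (left_nest x x' y \<cdot> ?t0)"
    by (simp add: left_nest_def)
  also have "\<dots> = scale (a \<otimes> b \<otimes> (f x x' y \<otimes> (\<i> f x y x' \<otimes> f y x x'))) (c y (x \<oplus> x'))"
    unfolding 1 2 3 4 5 6 by simp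
  also have "f x x' y \<otimes> (\<i> f x y x' \<otimes> f y x x') = factor x x' y"
    by (simp add: factor_def A.m_ac)
  finally show "c (x \<oplus> x') y \<cdot> add1 (commutator C R c) x x' y (scale a (base x y)) (scale b (base x' y))
      = scale (a \<otimes> b \<otimes> factor x x' y) (c y (x \<oplus> x'))" .
qed (use assms in \<open>simp_all add: commutator_def\<close>)

text \<open>The associators are those of the first law for (y, y'; x), met in reverse order and each
  inverted, which is why the inverse of \<open>factor y y' x\<close> appears.\<close>

lemma add2_base:
  assumes x: "x \<in> carrier (pi0 C)" and y: "y \<in> carrier (pi0 C)" and y': "y' \<in> carrier (pi0 C)"
    and a: "a \<in> carrier (pi1 C)" and b: "b \<in> carrier (pi1 C)"
  shows "add2 (commutator C R c) x y y' (scale a (base x y)) (scale b (base x y'))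
    = scale (a \<otimes> b \<otimes> \<i> factor y y' x) (base x (y \<oplus> y'))"
proof (rule base_unique)
  note [simp] = x y y' a b
  let ?t5 = "Inv C (c y y') \<boxtimes> Id C (R x)"
  let ?t4 = "Inv C (Assoc C (R y) (R y') (R x)) \<cdot> ?t5"
  let ?t3 = "(Id C (R y) \<boxtimes> base x y') \<cdot> ?t4"
  let ?t2 = "Assoc C (R y) (R x) (R y') \<cdot> ?t3"
  let ?t1 = "(base x y \<boxtimes> Id C (R y')) \<cdot> ?t2"
  let ?t0 = "Inv C (Assoc C (R x) (R y) (R y')) \<cdot> ?t1"
  have 1: "right_nest x y y' \<cdot> ?t0 = scale (\<i> f x y y') (left_nest x y y' \<cdot> ?t1)"
    using Comp_reassoc [OF right_nest_Inv_Assoc, of x y y' ?t1] by simp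
  have 2: "left_nest x y y' \<cdot> ?t1 = left_nest y x y' \<cdot> ?t2"
    by (rule Comp_reassoc [OF left_nest_base]) simp_all
  have 3: "left_nest y x y' \<cdot> ?t2 = scale (f y x y') (right_nest y x y' \<cdot> ?t3)"
    using Comp_reassoc [OF left_nest_Assoc, of y x y' ?t3] by simp
  have 4: "right_nest y x y' \<cdot> ?t3 = right_nest y y' x \<cdot> ?t4"
    by (rule Comp_reassoc [OF right_nest_base]) simp_all
  have 5: "right_nest y y' x \<cdot> ?t4 = scale (\<i> f y y' x) (left_nest y y' x \<cdot> ?t5)"
    using Comp_reassoc [OF right_nest_Inv_Assoc, of y y' x ?t5] by simp
  have 6: "left_nest y y' x \<cdot> ?t5 = c (y \<oplus> y') x"
    by (rule left_nest_Inv_c) simp_all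
  have "add2 (commutator C R c) x y y' (scale a (base x y)) (scale b (base x y'))
      = scale (a \<otimes> b) ((Id C (R x) \<boxtimes> c y y') \<cdot> ?t0)"
    by (simp add: commutator_def A.m_comm)
  then have "c x (y \<oplus> y') \<cdot> add2 (commutator C R c) x y y' (scale a (base x y)) (scale b (base x y'))
      = scale (a \<otimes> b) (right_nest x y y' \<cdot> ?t0)"
    by (simp add: right_nest_def)
  also have "\<dots> = scale (a \<otimes> b \<otimes> (\<i> f x y y' \<otimes> (f y x y' \<otimes> \<i> f y y' x))) (c (y \<oplus> y') x)"
    unfolding 1 2 3 4 5 6 by simp
  also have "\<i> f x y y' \<otimes> (f y x y' \<otimes> \<i> f y y' x) = \<i> factor y y' x"
    by (simp add: factor_def A.m_ac A.inv_mult)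
  finally show "c x (y \<oplus> y') \<cdot> add2 (commutator C R c) x y y' (scale a (base x y)) (scale b (base x y'))
      = scale (a \<otimes> b \<otimes> \<i> factor y y' x) (c (y \<oplus> y') x)" .
qed (use assms in \<open>simp_all add: commutator_def\<close>)

section \<open>Identities of the factor set\<close>

lemma factor_times:
  "\<lbrakk>x \<in> carrier (pi0 C); x' \<in> carrier (pi0 C); y \<in> carrier (pi0 C)\<rbrakk>
    \<Longrightarrow> factor x x' y \<otimes> f x y x' = f y x x' \<otimes> f x x' y"
  by (simp add: factor_def A.m_assoc)

text \<open>The quotient of the two sides is exactly the trilinear map at (y, x, x').\<close>

lemma factor_comm:
  assumes x: "x \<in> carrier (pi0 C)" and x': "x' \<in> carrier (pi0 C)" and y: "y \<in> carrier (pi0 C)"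
    and trivial: "trilinear_map C R c y x x' = \<one>\<^bsub>pi1 C\<^esub>"
  shows "factor x x' y = factor x' x y"
proof (rule A.cancel_mult [where z = "f x y x' \<otimes> f x' y x"])
  note [simp] = x x' y
  have "(f y x x' \<otimes> f x' y x \<otimes> f x x' y) \<otimes> \<i> (f y x' x \<otimes> f x' x y \<otimes> f x y x') = \<one>\<^bsub>pi1 C\<^esub>"
    using trivial by (simp only: trilinear_map_def Let_def)
  then have *: "f y x x' \<otimes> f x' y x \<otimes> f x x' y = f y x' x \<otimes> f x' x y \<otimes> f x y x'"
    by (subst (asm) A.inv_solve_right') simp_all
  have "factor x x' y \<otimes> (f x y x' \<otimes> f x' y x) = (factor x x' y \<otimes> f x y x') \<otimes> f x' y x"
    by (simp add: A.m_assoc)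
  also have "\<dots> = f y x x' \<otimes> f x' y x \<otimes> f x x' y"
    by (simp only: factor_times x x' y) (simp add: A.m_ac)
  also have "\<dots> = (factor x' x y \<otimes> f x' y x) \<otimes> f x y x'"
    unfolding * by (simp only: factor_times x x' y)
  also have "\<dots> = factor x' x y \<otimes> (f x y x' \<otimes> f x' y x)"
    by (simp add: A.m_ac)
  finally show "factor x x' y \<otimes> (f x y x' \<otimes> f x' y x) = factor x' x y \<otimes> (f x y x' \<otimes> f x' y x)" .
qed (use assms in simp_all)

text \<open>Neighbouring shuffles differ by one exchange, and commutativity of B makes the value of
  \<open>f\<close> at the sum of the two exchanged classes the same for both. These common values
  cancel in the alternating product of the four cocycle identities.\<close>

lemma factor_cocycle:
  assumes x: "x \<in> carrier (pi0 C)" and x': "x' \<in> carrier (pi0 C)" and x'': "x'' \<in> carrier (pi0 C)"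
    and y: "y \<in> carrier (pi0 C)"
  shows "factor x x' y \<otimes> factor (x \<oplus> x') x'' y = factor x' x'' y \<otimes> factor x (x' \<oplus> x'') y"
proof -
  note [simp] = x x' x'' y
  have 1: "f x x' x'' \<otimes> f y (x \<oplus> x') x'' \<otimes> f y x x' = f (x \<oplus> y) x' x'' \<otimes> f y x (x' \<oplus> x'')"
    using cocycle_identity [of y x x' x''] B.m_comm [of y x] by simp
  have 2: "f y x' x'' \<otimes> f x (x' \<oplus> y) x'' \<otimes> f x y x' = f (x \<oplus> y) x' x'' \<otimes> f x y (x' \<oplus> x'')"
    using cocycle_identity [of x y x' x''] B.m_comm [of y x'] by simp
  have 3: "f x' y x'' \<otimes> f x (x' \<oplus> y) x'' \<otimes> f x x' y = f (x \<oplus> x') y x'' \<otimes> f x x' (x'' \<oplus> y)"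
    using cocycle_identity [of x x' y x''] B.m_comm [of y x''] by simp
  have 4: "f x' x'' y \<otimes> f x (x' \<oplus> x'') y \<otimes> f x x' x'' = f (x \<oplus> x') x'' y \<otimes> f x x' (x'' \<oplus> y)"
    using cocycle_identity [of x x' x'' y] by simp
  show ?thesis
    \<comment> \<open>The equations determine the twenty group elements by unification, so the
      membership premises are skipped and discharged last.\<close>
    by (rule A.shuffle_relation_3_1 [OF _ _ _ _ _ _ _ _ _ _ _ _ _ _ _ _ _ _ _ _
          factor_times factor_times factor_times factor_times 1 2 3 4]) simp_all
qed

text \<open>The facts \<open>1\<close> to \<open>6\<close> run through the six shuffles of (x, x')
  with (y, y'), of which \<open>2\<close> and \<open>5\<close> are odd.\<close>

lemma factor_interchange:
  assumes x: "x \<in> carrier (pi0 C)" and x': "x' \<in> carrier (pi0 C)"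
    and y: "y \<in> carrier (pi0 C)" and y': "y' \<in> carrier (pi0 C)"
  shows "factor x x' y \<otimes> factor x x' y' \<otimes> (factor y y' x \<otimes> factor y y' x')
    = factor x x' (y \<oplus> y') \<otimes> factor y y' (x \<oplus> x')"
proof -
  note [simp] = x x' y y'
  have 1: "f x' y y' \<otimes> f x (x' \<oplus> y) y' \<otimes> f x x' y = f (x \<oplus> x') y y' \<otimes> f x x' (y \<oplus> y')"
    using cocycle_identity [of x x' y y'] by simp
  have 2: "f y x' y' \<otimes> f x (x' \<oplus> y) y' \<otimes> f x y x' = f (x \<oplus> y) x' y' \<otimes> f x y (x' \<oplus> y')"
    using cocycle_identity [of x y x' y'] B.m_comm [of y x'] by simp
  have 3: "f y y' x' \<otimes> f x (y \<oplus> y') x' \<otimes> f x y y' = f (x \<oplus> y) y' x' \<otimes> f x y (x' \<oplus> y')"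
    using cocycle_identity [of x y y' x'] B.m_comm [of y' x'] by simp
  have 4: "f x x' y' \<otimes> f y (x \<oplus> x') y' \<otimes> f y x x' = f (x \<oplus> y) x' y' \<otimes> f y x (x' \<oplus> y')"
    using cocycle_identity [of y x x' y'] B.m_comm [of y x] by simp
  have 5: "f x y' x' \<otimes> f y (x \<oplus> y') x' \<otimes> f y x y' = f (x \<oplus> y) y' x' \<otimes> f y x (x' \<oplus> y')"
    using cocycle_identity [of y x y' x'] B.m_comm [of y x] B.m_comm [of y' x'] by simp
  have 6: "f y' x x' \<otimes> f y (x \<oplus> y') x' \<otimes> f y y' x = f (y \<oplus> y') x x' \<otimes> f y y' (x \<oplus> x')"
    using cocycle_identity [of y y' x x'] B.m_comm [of y' x] by simp
  show ?thesis
    by (rule A.shuffle_relation_2_2 [OF _ _ _ _ _ _ _ _ _ _ _ _ _ _ _ _ _ _ _ _ _ _ _ _ _ _ _ _ _ _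
          factor_times factor_times factor_times factor_times factor_times factor_times
          1 2 3 4 5 6]) simp_all
qed

lemma factor_diagonal:
  assumes x: "x \<in> carrier (pi0 C)" and y: "y \<in> carrier (pi0 C)"
  shows "factor x y (x \<oplus> y) = factor x y x \<otimes> factor x y y"
proof (rule A.cancel_mult [where z = "f x (x \<oplus> y) y"])
  note [simp] = x y
  \<comment> \<open>A repeated argument makes one of the two numerators of \<open>factor\<close>
    equal to its denominator.\<close>
  have 1: "factor x y x = f x y x"
    by (rule A.cancel_mult [where z = "f x x y"], simp only: factor_times x y, rule A.m_comm)
      simp_all
  have 2: "factor x y y = f y x y"
    by (simp add: factor_def A.m_assoc)
  have "factor x y (x \<oplus> y) \<otimes> f x (x \<oplus> y) y = f (x \<oplus> y) x y \<otimes> f x y (x \<oplus> y)"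
    by (simp only: factor_times x y B.m_closed)
  also have "\<dots> = f y x y \<otimes> f x (x \<oplus> y) y \<otimes> f x y x"
    using cocycle_identity [of x y x y] B.m_comm [of y x] by simp
  also have "\<dots> = factor x y x \<otimes> factor x y y \<otimes> f x (x \<oplus> y) y"
    unfolding 1 2 by (simp add: A.m_ac)
  finally show "factor x y (x \<oplus> y) \<otimes> f x (x \<oplus> y) y
      = factor x y x \<otimes> factor x y y \<otimes> f x (x \<oplus> y) y" .
qed (use assms in simp_all)

lemma antisymmetric_factor_set_commutator:
  assumes trivial: "\<forall>x \<in> carrier (pi0 C). \<forall>y \<in> carrier (pi0 C). \<forall>z \<in> carrier (pi0 C).
    trilinear_map C R c x y z = \<one>\<^bsub>pi1 C\<^esub>"
  shows "antisymmetric_factor_set (pi1 C) (pi0 C) (commutator C R c) base factor"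
proof -
  have act: "act (fib (commutator C R c) x y) a (base x y) = scale a (base x y)"
    if "x \<in> carrier (pi0 C)" "y \<in> carrier (pi0 C)" for x y a
    using that by (simp add: commutator_def scale_def)
  show ?thesis
  proof
    fix x y assume "x \<in> carrier (pi0 C)" "y \<in> carrier (pi0 C)"
    then show "is_torsor (pi1 C) (fib (commutator C R c) x y)"
      "base x y \<in> pts (fib (commutator C R c) x y)"
      by (simp_all add: scale_torsor) (simp add: commutator_def Isom_eq_Hom Hom_iff)
  next
    fix x x' y assume "x \<in> carrier (pi0 C)" "x' \<in> carrier (pi0 C)" "y \<in> carrier (pi0 C)"
    then show "factor x x' y = factor x' x y"
      using trivial by (intro factor_comm) blast+
  qed (simp_all add: act add1_base add2_base factor_cocycle factor_interchange factor_diagonal)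
qed

end

theorem proposition5p1:
  fixes C :: "('o, 'm) monoidal_data"
    and R :: "'o set \<Rightarrow> 'o"
    and c :: "'o set \<Rightarrow> 'o set \<Rightarrow> 'm"
  assumes "group_like_monoidal_groupoid C"
    and "comm_group (pi0 C)"
    and "comm_group (pi1 C)"
    and "trivial_action C"
    and "is_choice C R c"
    and "\<forall>x \<in> carrier (pi0 C). \<forall>y \<in> carrier (pi0 C). \<forall>z \<in> carrier (pi0 C).
           trilinear_map C R c x y z = \<one>\<^bsub>pi1 C\<^esub>"
  shows "alternating_biextension (pi1 C) (pi0 C) (commutator C R c)"
proof -
  interpret central_choice C R c
    using assms by (intro central_choice.intro central_choice_axioms.intro)
  show ?thesis
    using antisymmetric_factor_set.alternating [OF antisymmetric_factor_set_commutator [OF assms(6)]] .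
qed

end
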